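(* Let $0\le p\le1$, $\delta\in(0,1)$, $\epsilon\in[0,1]$. For $p_X\in\mathcal{F}_\epsilon$ and $\sigma_w>0$, let $\sigma_h$ denote the highest fixed point of $\Psi_{\lambda_*,p}(\sigma^2)$, i.e. the largest $\sigma$ with $\Psi_{\lambda_*,p}(\sigma^2)=\sigma^2$. If $\overline{M}_p(\epsilon)<\delta$, then for every $p_X\in\mathcal{F}_\epsilon$ and $\sigma_w>0$ $$\frac{\sigma_h^2}{\sigma_w^2}\le\frac{1}{1-\frac{\overline{M}_p(\epsilon)}{\delta}}.$$ Furthermore, there exist a distribution $p_X\in\mathcal{F}_\epsilon$ and a noise variance $\sigma_w^2$ for which $$\frac{\sigma_h^2}{\sigma_w^2}\ge\frac{1}{1-\frac{\underline{M}_p(\epsilon)}{\delta}}.$$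
   Context: For $0\le p\le1$, $\lambda\ge0$, $u\in\mathbb{R}$: $\eta_p(u;\lambda)=\arg\min_{x\in\mathbb{R}}\frac12(u-x)^2+\lambda|x|^p$ (with $|x|^0=\mathbb{I}(x\neq0)$), the value $0$ being chosen when the minimizer is not unique. $\mathcal{F}_\epsilon$ is the set of probability distributions $p_X$ on $\mathbb{R}$ (with finite second moment) such that $P(X\ne0)\le\epsilon$ for $X\sim p_X$. State evolution map with optimal thresholding policy: for $\sigma\ge0$, $$\Psi_{\lambda_*,p}(\sigma^2)=\sigma_w^2+\frac1\delta\inf_{\lambda\ge0}\mathbb{E}\left|\eta_p(X+\sigma Z;\lambda)-X\right|^2,$$ with $X\sim p_X$ and $Z\sim N(0,1)$ independent. With $Z\sim N(0,1)$, $$\overline{M}_p(\epsilon)=\inf_{\tau\ge0}\sup_{\mu\ge0}\left[(1-\epsilon)\mathbb{E}(\eta_p(Z;\tau))^2+\epsilon\,\mathbb{E}(\eta_p(\mu+Z;\tau)-\mu)^2\right],$$ $$\underline{M}_p(\epsilon)=\sup_{\mu\ge0}\inf_{\tau\ge0}\left[(1-\epsilon)\mathbb{E}(\eta_p(Z;\tau))^2+\epsilon\,\mathbb{E}(\eta_p(\mu+Z;\tau)-\mu)^2\right].$$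
   Formalization: For p = 1 and ε > 0 the lower bound is shown only as a supremum (every c below it is reached), since exact attainment fails for p = 1, 0 < ε < 1 when the lower minimax risk is below δ; for p < 1 or ε = 0 it is attained as stated. *)

theory Defs
  imports "HOL-Probability.Probability"
begin

(* Since 0 powr 0 = 0 and x powr 0 = 1 for x ~= 0, the term \<bar>x\<bar> powr p is also right for p = 0,
   where it is the indicator of x ~= 0. *)
definition prox_objective :: "real \<Rightarrow> real \<Rightarrow> real \<Rightarrow> real \<Rightarrow> real" where
  "prox_objective p l u x = (u - x)\<^sup>2 / 2 + l * \<bar>x\<bar> powr p"

definition eta :: "real \<Rightarrow> real \<Rightarrow> real \<Rightarrow> real" where
  "eta p u l =
     (if \<exists>!x. is_arg_min (prox_objective p l u) (\<lambda>_. True) x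
      then THE x. is_arg_min (prox_objective p l u) (\<lambda>_. True) x
      else 0)"

definition std_gauss :: "real measure" where
  "std_gauss = density lborel (\<lambda>z. ennreal (std_normal_density z))"

definition sparse_dists :: "real \<Rightarrow> real measure set" where
  "sparse_dists eps =
     {PX. prob_space PX \<and> sets PX = sets borel \<and> integrable PX (\<lambda>x. x\<^sup>2)
          \<and> measure PX {x. x \<noteq> 0} \<le> eps}"

(* X and Z are independent, so their joint law is the product measure. *)
definition amp_risk :: "real \<Rightarrow> real measure \<Rightarrow> real \<Rightarrow> real \<Rightarrow> real" where
  "amp_risk p PX s l =
     (LINT xz|(PX \<Otimes>\<^sub>M std_gauss). \<bar>eta p (fst xz + s * snd xz) l - fst xz\<bar>\<^sup>2)"

(* The last argument v is the variance sigma^2; sw is the noise standard deviation. *)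
definition Psi :: "real \<Rightarrow> real \<Rightarrow> real \<Rightarrow> real measure \<Rightarrow> real \<Rightarrow> real" where
  "Psi p \<delta> sw PX v = sw\<^sup>2 + 1 / \<delta> * (INF l\<in>{0..}. amp_risk p PX (sqrt v) l)"

definition highest_fixed_point :: "real \<Rightarrow> real \<Rightarrow> real \<Rightarrow> real measure \<Rightarrow> real \<Rightarrow> bool" where
  "highest_fixed_point p \<delta> sw PX sh \<longleftrightarrow>
     0 \<le> sh \<and> Psi p \<delta> sw PX (sh\<^sup>2) = sh\<^sup>2 \<and>
     (\<forall>s\<ge>0. Psi p \<delta> sw PX (s\<^sup>2) = s\<^sup>2 \<longrightarrow> s \<le> sh)"

definition two_point_risk :: "real \<Rightarrow> real \<Rightarrow> real \<Rightarrow> real \<Rightarrow> real" where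
  "two_point_risk p \<epsilon> \<mu> \<tau> =
     (1 - \<epsilon>) * (LINT z|std_gauss. (eta p z \<tau>)\<^sup>2)
     + \<epsilon> * (LINT z|std_gauss. (eta p (\<mu> + z) \<tau> - \<mu>)\<^sup>2)"

(* The real-valued suprema and infima below are genuine for 0 <= p <= 1 and 0 <= \<epsilon> <= 1: the risk is
   nonnegative; for fixed \<tau> it is bounded in \<mu>, because \<bar>eta p u \<tau> - u\<bar> is bounded in u; and its
   infimum over \<tau> is at most its value 1 at \<tau> = 0. *)
definition M_upper :: "real \<Rightarrow> real \<Rightarrow> real" where
  "M_upper p \<epsilon> = (INF \<tau>\<in>{0..}. SUP \<mu>\<in>{0..}. two_point_risk p \<epsilon> \<mu> \<tau>)"

definition M_lower :: "real \<Rightarrow> real \<Rightarrow> real" where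
  "M_lower p \<epsilon> = (SUP \<mu>\<in>{0..}. INF \<tau>\<in>{0..}. two_point_risk p \<epsilon> \<mu> \<tau>)"

end

theory Submission
  imports Defs "HOL-Real_Asymp.Real_Asymp"
begin

text \<open>
  Only two features of the noise level enter. First, \<open>\<sigma> R(\<sigma>)\<close> is nondecreasing, where \<open>R\<close> is the
  optimally tuned risk, because the density of \<open>\<sigma> Z\<close> dominates \<open>s / \<sigma>\<close> times that of \<open>s Z\<close> for
  \<open>s \<le> \<sigma>\<close>; together with \<open>R(\<sigma>) \<le> E X\<^sup>2\<close> (take \<open>\<lambda> \<rightarrow> \<infinity>\<close>) this yields a highest fixed point for every
  law without any continuity argument. Second, the scaling \<open>\<eta>(c u; \<lambda>) = c \<eta>(u; \<lambda> c\<^bsup>p-2\<^esup>)\<close> reduces \<open>R(\<sigma>) / \<sigma>\<^sup>2\<close>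
  to unit noise, where it is at most the minimax risk; this is the upper bound. For the lower bound,
  a two-point law at \<open>0\<close> and \<open>\<mu>\<close> with noise variance \<open>1 - h(\<mu>) / \<delta>\<close> has \<open>\<sigma> = 1\<close> as a fixed point,
  where \<open>h(\<mu>)\<close> is its best unit-noise risk.

  Attaining the lower minimax value for \<open>p < 1\<close> requires that the supremum of \<open>h\<close> is not approached only at
  infinity. There \<open>h\<close> is asymptotically at most \<open>\<epsilon>\<close>, whereas for large finite \<open>\<mu>\<close> thresholding never beats the
  identity estimator, so that \<open>h(\<mu>) \<ge> \<epsilon>\<close>.
\<close>

section \<open>The thresholding function\<close>

abbreviation minimizer :: "real \<Rightarrow> real \<Rightarrow> real \<Rightarrow> real \<Rightarrow> bool" where
  "minimizer p l u x \<equiv> is_arg_min (prox_objective p l u) (\<lambda>_. True) x"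

lemma minimizer_iff:
  "minimizer p l u x \<longleftrightarrow> (\<forall>y. prox_objective p l u x \<le> prox_objective p l u y)"
  by (auto simp: is_arg_min_linorder)

lemma prox_objective_scale:
  assumes "c \<noteq> 0"
  shows "prox_objective p l (c * u) (c * x) = c\<^sup>2 * prox_objective p (l * \<bar>c\<bar> powr (p - 2)) u x"
proof -
  have "\<bar>c\<bar> powr p = c\<^sup>2 * \<bar>c\<bar> powr (p - 2)"
    using assms by (simp add: powr_diff powr_numeral)
  then show ?thesis
    by (simp add: prox_objective_def abs_mult powr_mult power2_eq_square algebra_simps)
qed

lemma minimizer_scale:
  assumes "c \<noteq> 0"
  shows "minimizer p l (c * u) (c * x) \<longleftrightarrow> minimizer p (l * \<bar>c\<bar> powr (p - 2)) u x"
proof -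
  have "(\<forall>y. prox_objective p l (c * u) (c * x) \<le> prox_objective p l (c * u) y)
      \<longleftrightarrow> (\<forall>y. prox_objective p l (c * u) (c * x) \<le> prox_objective p l (c * u) (c * y))"
    (is "?L \<longleftrightarrow> ?R")
  proof
    assume R: ?R
    show ?L
    proof
      fix y show "prox_objective p l (c * u) (c * x) \<le> prox_objective p l (c * u) y"
        using R[rule_format, of "y / c"] assms by simp
    qed
  qed blast
  then show ?thesis
    using assms by (simp add: minimizer_iff prox_objective_scale)
qed

text \<open>Multiplication by \<open>c\<close> maps one minimizer set bijectively onto the other and
  fixes 0, so the default branch of \<open>eta\<close> scales as well. Negative \<open>c\<close> is
  included and yields oddness.\<close>

lemma eta_scale:
  assumes "c \<noteq> 0"
  shows "eta p (c * u) l = c * eta p u (l * \<bar>c\<bar> powr (p - 2))"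
proof -
  define l' where "l' = l * \<bar>c\<bar> powr (p - 2)"
  have iff: "minimizer p l (c * u) (c * x) \<longleftrightarrow> minimizer p l' u x" for x
    unfolding l'_def by (rule minimizer_scale[OF assms])
  have iff': "minimizer p l (c * u) y \<longleftrightarrow> minimizer p l' u (y / c)" for y
    using iff[of "y / c"] assms by simp
  have ex: "(\<exists>!x. minimizer p l (c * u) x) \<longleftrightarrow> (\<exists>!x. minimizer p l' u x)"
  proof
    assume "\<exists>!x. minimizer p l (c * u) x"
    then obtain x where x: "minimizer p l (c * u) x" "\<And>y. minimizer p l (c * u) y \<Longrightarrow> y = x"
      by blast
    show "\<exists>!x. minimizer p l' u x"
    proof (rule ex1I[of _ "x / c"])
      show "minimizer p l' u (x / c)" using x(1) by (simp only: iff')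
      fix y assume "minimizer p l' u y"
      then have "c * y = x" using x(2) by (simp only: iff[symmetric])
      then show "y = x / c" using assms by auto
    qed
  next
    assume "\<exists>!x. minimizer p l' u x"
    then obtain x where x: "minimizer p l' u x" "\<And>y. minimizer p l' u y \<Longrightarrow> y = x"
      by blast
    show "\<exists>!x. minimizer p l (c * u) x"
    proof (rule ex1I[of _ "c * x"])
      show "minimizer p l (c * u) (c * x)" using x(1) by (simp only: iff)
      fix y assume "minimizer p l (c * u) y"
      then have "y / c = x" using x(2) by (simp only: iff')
      then show "y = c * x" using assms by auto
    qed
  qed
  show ?thesis
  proof (cases "\<exists>!x. minimizer p l' u x")
    case True
    then obtain x where x: "minimizer p l' u x" by blast
    have "(THE x. minimizer p l' u x) = x" using True x by (rule the1_equality)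
    moreover have "(THE x. minimizer p l (c * u) x) = c * x"
      by (rule the1_equality) (use True ex x iff in blast)+
    ultimately show ?thesis
      using True ex by (simp add: eta_def l'_def[symmetric])
  qed (use ex in \<open>simp add: eta_def l'_def[symmetric]\<close>)
qed

lemma eta_minus: "eta p (- u) l = - eta p u l"
  using eta_scale[of "-1" p u l] by simp

text \<open>Adding the two optimality inequalities cancels the penalties and leaves
  \<open>0 \<le> (u' - u) * (x' - x)\<close>.\<close>

lemma minimizer_mono:
  assumes "minimizer p l u x" "minimizer p l u' x'" "u < u'"
  shows "x \<le> x'"
proof -
  have "prox_objective p l u x \<le> prox_objective p l u x'"
       "prox_objective p l u' x' \<le> prox_objective p l u' x"
    using assms by (auto simp: minimizer_iff)
  then have "0 \<le> (u' - u) * (x' - x)"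
    by (simp add: prox_objective_def power2_eq_square field_simps)
  then show ?thesis using assms(3) by (simp add: zero_le_mult_iff)
qed

lemma minimizer_exists:
  assumes "0 \<le> p" "0 \<le> l"
  shows "\<exists>x. minimizer p l u x"
proof (cases "p = 0")
  \<comment> \<open>For \<open>p = 0\<close> the objective may jump at 0, so the minimizer is
    exhibited directly: it is 0 or \<open>u\<close>.\<close>
  case True
  have pos: "y = 0 \<or> l \<le> prox_objective p l u y" for y
    using True assms by (auto simp: prox_objective_def)
  show ?thesis
  proof (cases "u\<^sup>2 / 2 \<le> l \<or> u = 0")
    case T: True
    have "minimizer p l u 0"
      unfolding minimizer_iff
    proof
      fix y show "prox_objective p l u 0 \<le> prox_objective p l u y"
        using T pos[of y] assms by (auto simp: prox_objective_def)
    qed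
    then show ?thesis ..
  next
    case F: False
    have "minimizer p l u u"
      unfolding minimizer_iff
    proof
      fix y show "prox_objective p l u u \<le> prox_objective p l u y"
        using F True pos[of y] by (auto simp: prox_objective_def)
    qed
    then show ?thesis ..
  qed
next
  case False
  then have p: "0 < p" using assms by simp
  \<comment> \<open>Outside this compact interval the competitor 0 does at least as well, because
    \<open>\<bar>u\<bar> \<le> \<bar>u - y\<bar>\<close> there.\<close>
  have "continuous_on {- 2 * \<bar>u\<bar>..2 * \<bar>u\<bar>} (prox_objective p l u)"
    unfolding prox_objective_def using p by (intro continuous_intros continuous_on_powr') auto
  then obtain x where x: "\<forall>y\<in>{- 2 * \<bar>u\<bar>..2 * \<bar>u\<bar>}. prox_objective p l u x \<le> prox_objective p l u y"
    using continuous_attains_inf[of "{- 2 * \<bar>u\<bar>..2 * \<bar>u\<bar>}" "prox_objective p l u"] by auto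
  have "prox_objective p l u x \<le> prox_objective p l u y" for y
  proof (cases "y \<in> {- 2 * \<bar>u\<bar>..2 * \<bar>u\<bar>}")
    case False
    then have "\<bar>u\<bar> \<le> \<bar>u - y\<bar>" by auto
    then have "u\<^sup>2 \<le> (u - y)\<^sup>2" by (simp add: abs_le_square_iff)
    moreover have "0 \<le> l * \<bar>y\<bar> powr p" using assms by simp
    ultimately have "prox_objective p l u 0 \<le> prox_objective p l u y"
      unfolding prox_objective_def by (simp add: field_simps)
    moreover have "prox_objective p l u x \<le> prox_objective p l u 0" using x by simp
    ultimately show ?thesis by simp
  qed (use x in blast)
  then show ?thesis by (auto simp: minimizer_iff)
qed

lemma minimizer_range:
  assumes "0 \<le> p" "0 \<le> l" "0 \<le> u" "minimizer p l u x"
  shows "0 \<le> x" "x \<le> u"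
proof -
  have min: "prox_objective p l u x \<le> prox_objective p l u y" for y
    using assms(4) by (simp add: minimizer_iff)
  show "0 \<le> x"
  proof (rule ccontr)
    assume "\<not> 0 \<le> x"
    then have "u * x \<le> 0" "0 < x * x" using assms(3) by (auto simp: mult_le_0_iff mult_neg_neg)
    moreover have "0 \<le> l * \<bar>x\<bar> powr p" using assms by simp
    ultimately have "prox_objective p l u 0 < prox_objective p l u x"
      by (simp add: prox_objective_def power2_eq_square field_simps)
    then show False using min[of 0] by simp
  qed
  show "x \<le> u"
  proof (rule ccontr)
    assume n: "\<not> x \<le> u"
    have "l * \<bar>u\<bar> powr p \<le> l * \<bar>x\<bar> powr p"
      using n assms by (intro mult_left_mono powr_mono2) auto
    moreover have "0 < (u - x)\<^sup>2 / 2" using n by simp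
    moreover have "prox_objective p l u u = l * \<bar>u\<bar> powr p" by (simp add: prox_objective_def)
    ultimately have "prox_objective p l u u < prox_objective p l u x"
      unfolding prox_objective_def[of _ _ _ x] by linarith
    then show False using min[of u] by simp
  qed
qed

text \<open>The first-order condition is multiplied by \<open>x\<close>, which makes its right-hand
  side \<open>p\<close> times the penalty; it can then eliminate the penalty from comparisons of
  objective values.\<close>

lemma minimizer_stationary:
  assumes "minimizer p l u x" "0 < x"
  shows "(u - x) * x = p * l * x powr p"
proof -
  have der: "((\<lambda>x. (u - x)\<^sup>2 / 2 + l * x powr p) has_real_derivative
        (x - u + l * (p * x powr (p - 1)))) (at x)"
    using assms(2) by (auto intro!: derivative_eq_intros simp: field_simps powr_diff)
  have "x - u + l * (p * x powr (p - 1)) = 0"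
  proof (rule DERIV_local_min[OF der assms(2)], intro allI impI)
    fix y assume "\<bar>x - y\<bar> < x"
    then have "0 < y" by auto
    moreover have "prox_objective p l u x \<le> prox_objective p l u y"
      using assms(1) by (simp add: minimizer_iff)
    ultimately show "(u - x)\<^sup>2 / 2 + l * x powr p \<le> (u - y)\<^sup>2 / 2 + l * y powr p"
      using assms(2) by (simp add: prox_objective_def)
  qed
  then have "u - x = l * p * x powr (p - 1)" by simp
  then show ?thesis using assms(2) by (simp add: powr_diff)
qed

text \<open>The stationarity condition turns the comparison with the competitor 0 into a bound on the
  shrinkage that no longer involves the penalty level.\<close>

lemma minimizer_shrinkage_le:
  assumes "0 \<le> p" "0 \<le> l" "0 \<le> u" "minimizer p l u x" "0 < x"
  shows "(2 - p) * (u - x) \<le> p * u"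
proof -
  have "prox_objective p l u x \<le> prox_objective p l u 0"
    using assms(4) by (simp add: minimizer_iff)
  then have "(u - x)\<^sup>2 / 2 + l * x powr p \<le> u\<^sup>2 / 2"
    using assms(5) by (simp add: prox_objective_def)
  then have "l * x powr p \<le> x * (u + (u - x)) / 2"
    by (simp add: power2_eq_square field_simps)
  then have "p * (l * x powr p) \<le> p * (x * (u + (u - x)) / 2)"
    using assms(1) by (rule mult_left_mono)
  then have "(u - x) * x \<le> (p * (u + (u - x)) / 2) * x"
    using minimizer_stationary[OF assms(4,5)] by (simp add: mult_ac)
  then have "u - x \<le> p * (u + (u - x)) / 2" using assms(5) by simp
  then show ?thesis by (simp add: algebra_simps)
qed

text \<open>Two minimizers have equal objective values. Multiplying by \<open>p\<close> and
  eliminating the penalties by stationarity leaves \<open>x - y\<close> times a second factor, which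
  the shrinkage bound makes positive for \<open>p < 1\<close>. For \<open>p = 1\<close> stationarity
  alone forces \<open>x = u - l\<close>.\<close>

lemma positive_minimizer_unique:
  assumes "0 \<le> p" "p \<le> 1" "0 \<le> l" "0 < u"
    and "minimizer p l u x" "0 < x" "minimizer p l u y" "0 < y"
  shows "x = y"
proof -
  have sx: "(u - x) * x = p * l * x powr p" and sy: "(u - y) * y = p * l * y powr p"
    using minimizer_stationary assms by blast+
  have "prox_objective p l u x = prox_objective p l u y"
    using assms by (auto simp: minimizer_iff intro: antisym)
  then have "p * ((u - x)\<^sup>2 / 2 + l * x powr p) = p * ((u - y)\<^sup>2 / 2 + l * y powr p)"
    using assms by (simp add: prox_objective_def)
  then have "p * (u - x)\<^sup>2 + 2 * ((u - x) * x) = p * (u - y)\<^sup>2 + 2 * ((u - y) * y)"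
    unfolding sx sy by (simp add: algebra_simps)
  then have eq: "(x - y) * (2 * u - (2 - p) * ((u - x) + (u - y))) = 0"
    by (simp add: power2_eq_square algebra_simps)
  show ?thesis
  proof (cases "p = 1")
    case True
    then show ?thesis using sx sy assms by simp
  next
    case False
    have "(2 - p) * ((u - x) + (u - y)) \<le> 2 * (p * u)"
      using minimizer_shrinkage_le[of p l u x] minimizer_shrinkage_le[of p l u y] assms
      by (simp add: algebra_simps)
    also have "\<dots> < 2 * u" using False assms by simp
    finally show ?thesis using eq by simp
  qed
qed

text \<open>At most one minimizer is positive, so non-uniqueness forces 0 to be a minimizer and the
  default value of \<open>eta\<close> is a correct choice.\<close>

lemma eta_minimizer_nonneg:
  assumes "0 \<le> p" "p \<le> 1" "0 \<le> l" "0 \<le> u"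
  shows "minimizer p l u (eta p u l)"
proof (cases "\<exists>!x. minimizer p l u x")
  case True
  then show ?thesis unfolding eta_def by (simp add: theI')
next
  case False
  obtain x where x: "minimizer p l u x" using minimizer_exists[of p l u] assms by blast
  then obtain y where y: "minimizer p l u y" "x \<noteq> y" using False by blast
  have "0 \<le> x" "0 \<le> y" "x \<le> u" "y \<le> u" using minimizer_range assms x y by blast+
  then have "x = 0 \<or> y = 0"
    using positive_minimizer_unique[of p l u x y] x y assms by fastforce
  then have "minimizer p l u 0" using x y by blast
  then show ?thesis using False by (simp add: eta_def)
qed

lemma eta_minimizer:
  assumes "0 \<le> p" "p \<le> 1" "0 \<le> l"
  shows "minimizer p l u (eta p u l)"
proof (cases "0 \<le> u")
  case False
  then have "minimizer p l (-u) (eta p (-u) l)" using eta_minimizer_nonneg[of p l "-u"] assms by simp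
  then show ?thesis using minimizer_scale[of "-1" p l "-u" "eta p (-u) l"] by (simp add: eta_minus)
qed (use assms eta_minimizer_nonneg in blast)

section \<open>Order, size and support of the thresholding function for admissible
  parameters\<close>

locale thresholding =
  fixes p l :: real
  assumes p: "0 \<le> p" "p \<le> 1" and l: "0 \<le> l"
begin

lemma eta_mono: "mono (\<lambda>u. eta p u l)"
proof (rule monoI)
  fix u v :: real assume "u \<le> v"
  then show "eta p u l \<le> eta p v l"
    using minimizer_mono[of p l u "eta p u l" v "eta p v l"] eta_minimizer p l by (cases "u = v") auto
qed

lemma eta_measurable [measurable]: "(\<lambda>u. eta p u l) \<in> borel_measurable borel"
  using eta_mono by (rule borel_measurable_mono)

lemma eta_range:
  assumes "0 \<le> u"
  shows "0 \<le> eta p u l" "eta p u l \<le> u"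
  using minimizer_range[OF p(1) l assms eta_minimizer] p l by auto

lemma eta_0 [simp]: "eta p 0 l = 0"
  using eta_range[of 0] by simp

text \<open>The estimate lies between 0 and \<open>x + w\<close>, so the error lies between
  \<open>- x\<close> and \<open>w\<close>. The bound is free of \<open>l\<close> and serves as the
  dominating function when \<open>l\<close> tends to infinity.\<close>

lemma eta_risk_le: "(eta p (x + w) l - x)\<^sup>2 \<le> x\<^sup>2 + w\<^sup>2"
proof -
  have "eta p (x + w) l - x \<in> {min (- x) w..max (- x) w}"
    using eta_range[of "x + w"] eta_range[of "- (x + w)"] unfolding eta_minus
    by (cases "0 \<le> x + w") (simp_all add: min_def max_def)
  then have "\<bar>eta p (x + w) l - x\<bar> \<le> max \<bar>x\<bar> \<bar>w\<bar>" by auto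
  then have "(eta p (x + w) l - x)\<^sup>2 \<le> (max \<bar>x\<bar> \<bar>w\<bar>)\<^sup>2"
    by (metis abs_ge_zero power2_abs power_mono)
  also have "\<dots> \<le> x\<^sup>2 + w\<^sup>2" by (simp add: max_def)
  finally show ?thesis .
qed

lemma eta_stationary:
  "0 < eta p u l \<Longrightarrow> (u - eta p u l) * eta p u l = p * l * eta p u l powr p"
  using minimizer_stationary eta_minimizer p l by blast

text \<open>Comparison with the competitor \<open>u\<close> bounds \<open>G\<^sup>2 / 2\<close> by
  \<open>l\<close> times the difference of the penalty powers of \<open>u\<close> and
  \<open>x\<close>. For \<open>G > 1\<close> that difference is at most \<open>G\<close>, whence
  \<open>G \<le> 2 * l\<close>.\<close>

lemma eta_shrinkage_bounded: "\<bar>u - eta p u l\<bar> \<le> max 1 (2 * l)"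
proof -
  have *: "u - eta p u l \<le> max 1 (2 * l)" if "0 \<le> u" for u
  proof (rule ccontr)
    define x where "x = eta p u l"
    define G where "G = u - x"
    assume "\<not> u - eta p u l \<le> max 1 (2 * l)"
    then have G: "1 < G" "2 * l < G" by (auto simp: G_def x_def)
    have x: "0 \<le> x" "x \<le> u" using eta_range[OF that] by (auto simp: x_def)
    then have u: "0 < u" using G by (simp add: G_def)
    \<comment> \<open>Subadditivity of the power: split \<open>u = x + G\<close> and use that the
      exponent \<open>p - 1\<close> is nonpositive.\<close>
    have "u powr p = x * u powr (p - 1) + G * u powr (p - 1)"
      using u by (simp add: powr_diff G_def field_simps)
    also have "\<dots> \<le> x powr p + G powr p"
    proof (rule add_mono)
      show "x * u powr (p - 1) \<le> x powr p"
      proof (cases "x = 0")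
        case False
        then have "x * u powr (p - 1) \<le> x * x powr (p - 1)"
          using x p by (intro mult_left_mono powr_mono2') auto
        then show ?thesis using False x by (simp add: powr_diff)
      qed simp
      have "G * u powr (p - 1) \<le> G * G powr (p - 1)"
        using x p G by (intro mult_left_mono powr_mono2') (auto simp: G_def)
      then show "G * u powr (p - 1) \<le> G powr p" using G by (simp add: powr_diff)
    qed
    also have "G powr p \<le> G powr 1" using G p by (intro powr_mono) auto
    finally have sub: "u powr p \<le> x powr p + G" using G by simp
    have "prox_objective p l u x \<le> prox_objective p l u u"
      using eta_minimizer[OF p l, of u] by (simp add: minimizer_iff x_def)
    then have "G\<^sup>2 / 2 + l * x powr p \<le> l * u powr p"
      using x u by (simp add: prox_objective_def G_def)
    also have "\<dots> \<le> l * (x powr p + G)" using sub l by (rule mult_left_mono)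
    finally have "G * G \<le> (2 * l) * G" by (simp add: power2_eq_square algebra_simps)
    then show False using G by simp
  qed
  show ?thesis
    using *[of u] *[of "-u"] eta_range[of u] eta_range[of "-u"] by (cases "0 \<le> u") (auto simp: eta_minus)
qed

text \<open>Moving from 0 to \<open>x > 0\<close> gains less than \<open>u * x\<close> in the
  quadratic term, and \<open>x \<le> u\<close> bounds this by
  \<open>u powr (2 - p) * x powr p\<close>, which is less than the penalty. The threshold is crude
  but grows with \<open>l\<close>.\<close>

lemma eta_eq_0:
  assumes "\<bar>u\<bar> powr (2 - p) < l"
  shows "eta p u l = 0"
proof -
  have *: "eta p u l = 0" if u: "0 \<le> u" and less: "u powr (2 - p) < l" for u
  proof (rule ccontr)
    define x where "x = eta p u l"
    assume "eta p u l \<noteq> 0"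
    then have x: "0 < x" "x \<le> u" using eta_range[OF u] by (auto simp: x_def)
    have "prox_objective p l u x \<le> prox_objective p l u 0"
      using eta_minimizer[OF p l, of u] by (simp add: minimizer_iff x_def)
    then have "l * x powr p \<le> u * x - x * x / 2"
      using x by (simp add: prox_objective_def power2_eq_square field_simps)
    also have "\<dots> < u * x" using x by simp
    also have "\<dots> = u * (x powr (1 - p) * x powr p)"
      using x by (simp add: powr_add[symmetric])
    also have "\<dots> \<le> u * (u powr (1 - p) * x powr p)"
      using x p by (intro mult_left_mono mult_right_mono powr_mono2) auto
    also have "\<dots> = u powr (2 - p) * x powr p"
      using x by (simp add: powr_diff power2_eq_square powr_numeral)
    finally show False using less x by simp
  qed
  show ?thesis
    using *[of u] *[of "-u"] assms by (cases "0 \<le> u") (auto simp: eta_minus)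
qed

end

section \<open>Gaussian risk\<close>

lemma sets_std_gauss [measurable_cong, simp]: "sets std_gauss = sets borel"
  by (simp add: std_gauss_def)

lemma space_std_gauss [simp]: "space std_gauss = UNIV"
  by (simp add: std_gauss_def)

lemma prob_space_std_gauss: "prob_space std_gauss"
  unfolding std_gauss_def by (rule prob_space_normal_density) simp

interpretation std_gauss: prob_space std_gauss
  by (rule prob_space_std_gauss)

lemma std_gauss_integral:
  fixes f :: "real \<Rightarrow> real"
  assumes "f \<in> borel_measurable borel"
  shows "(LINT z|std_gauss. f z) = (LINT z|lborel. std_normal_density z * f z)"
  using assms unfolding std_gauss_def by (subst integral_density) (auto simp: mult.commute)

lemma std_gauss_integrable_iff:
  fixes f :: "real \<Rightarrow> real"
  assumes "f \<in> borel_measurable borel"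
  shows "integrable std_gauss f \<longleftrightarrow> integrable lborel (\<lambda>z. std_normal_density z * f z)"
  using assms unfolding std_gauss_def by (subst integrable_density) (auto simp: mult.commute)

lemma std_gauss_square: "integrable std_gauss (\<lambda>z. z\<^sup>2)" "(LINT z|std_gauss. z\<^sup>2) = 1"
  using integrable_std_normal_moment[of 2] integral_std_normal_moment_even[of 1]
  by (simp_all add: std_gauss_integrable_iff std_gauss_integral fact_numeral)

lemma std_gauss_ident: "integrable std_gauss (\<lambda>z. z)" "(LINT z|std_gauss. z) = 0"
  using integrable_std_normal_moment[of 1] integral_std_normal_moment_odd[of 0]
  by (simp_all add: std_gauss_integrable_iff std_gauss_integral)

lemma std_gauss_uminus:
  fixes f :: "real \<Rightarrow> real"
  assumes [measurable]: "f \<in> borel_measurable borel"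
  shows "(LINT z|std_gauss. f (- z)) = (LINT z|std_gauss. f z)"
  using lborel_integral_real_affine[of "-1" "\<lambda>z. std_normal_density z * f z" 0]
  by (simp add: std_gauss_integral std_normal_density_def)

text \<open>Mean squared error given the signal value \<open>x\<close>: its average over
  \<open>x\<close> is \<open>amp_risk\<close>, and \<open>s = 1\<close> gives the two terms of
  \<open>two_point_risk\<close>.\<close>

definition risk :: "real \<Rightarrow> real \<Rightarrow> real \<Rightarrow> real \<Rightarrow> real" where
  "risk p l s x = (LINT z|std_gauss. (eta p (x + s * z) l - x)\<^sup>2)"

lemma risk_nonneg: "0 \<le> risk p l s x"
  unfolding risk_def by (intro integral_nonneg_AE) auto

lemma two_point_risk_eq:
  "two_point_risk p \<epsilon> \<mu> \<tau> = (1 - \<epsilon>) * risk p \<tau> 1 0 + \<epsilon> * risk p \<tau> 1 \<mu>"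
  by (simp add: two_point_risk_def risk_def)

context thresholding
begin

lemma risk_integrable: "integrable std_gauss (\<lambda>z. (eta p (x + s * z) l - x)\<^sup>2)"
proof (rule Bochner_Integration.integrable_bound)
  show "integrable std_gauss (\<lambda>z. x\<^sup>2 + s\<^sup>2 * z\<^sup>2)"
    using std_gauss_square by (intro Bochner_Integration.integrable_add) auto
  show "AE z in std_gauss. norm ((eta p (x + s * z) l - x)\<^sup>2) \<le> norm (x\<^sup>2 + s\<^sup>2 * z\<^sup>2)"
    using eta_risk_le[of x "s * z" for z] by (auto simp: power_mult_distrib)
qed measurable

text \<open>Oddness of \<open>eta\<close> and symmetry of the noise; hence suprema over nonnegative
  means also cover negative signals.\<close>

lemma risk_minus: "risk p l s (- x) = risk p l s x"
proof -
  have eq: "(eta p (- x + s * z) l - - x)\<^sup>2 = (eta p (x + s * (- z)) l - x)\<^sup>2" for z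
    using eta_minus[of p "x + s * (- z)" l] by (simp add: power2_eq_square algebra_simps)
  show ?thesis
    unfolding risk_def eq
    by (rule std_gauss_uminus[of "\<lambda>z. (eta p (x + s * z) l - x)\<^sup>2"]) measurable
qed

lemma risk_bounded: "\<exists>K. \<forall>x. risk p l 1 x \<le> K"
proof (intro exI allI)
  fix x
  define B where "B = max 1 (2 * l)"
  have "risk p l 1 x \<le> (LINT z|std_gauss. 2 * z\<^sup>2 + 2 * B\<^sup>2)"
    unfolding risk_def
  proof (rule integral_mono[OF risk_integrable])
    show "integrable std_gauss (\<lambda>z. 2 * z\<^sup>2 + 2 * B\<^sup>2)"
      using std_gauss_square by (intro Bochner_Integration.integrable_add) auto
    fix z
    define D where "D = x + z - eta p (x + z) l"
    have "D\<^sup>2 \<le> B\<^sup>2"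
      using eta_shrinkage_bounded[of "x + z"] by (auto simp: D_def B_def abs_le_square_iff[symmetric])
    \<comment> \<open>The error is \<open>z - D\<close> with the shrinkage \<open>D\<close> bounded
      uniformly in \<open>x\<close>; the parallelogram identity separates the two.\<close>
    moreover have "(z - D)\<^sup>2 + (z + D)\<^sup>2 = 2 * z\<^sup>2 + 2 * D\<^sup>2"
      by (simp add: power2_eq_square algebra_simps)
    ultimately have "(z - D)\<^sup>2 \<le> 2 * z\<^sup>2 + 2 * B\<^sup>2"
      using zero_le_power2[of "z + D"] by linarith
    then show "(eta p (x + 1 * z) l - x)\<^sup>2 \<le> 2 * z\<^sup>2 + 2 * B\<^sup>2"
      by (simp add: D_def power2_commute)
  qed
  then show "risk p l 1 x \<le> (LINT z|std_gauss. 2 * z\<^sup>2 + 2 * (max 1 (2 * l))\<^sup>2)"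
    by (simp add: B_def)
qed

text \<open>The density of \<^term>\<open>s' * Z\<close> is at least \<^term>\<open>s / s'\<close> times that of \<^term>\<open>s * Z\<close>.
  This one-sided bound replaces continuity of the risk in the noise level.\<close>

lemma risk_scale_mono:
  assumes "0 < s" "s \<le> s'"
  shows "s * risk p l s x \<le> s' * risk p l s' x"
proof -
  define F where "F w = (eta p (x + w) l - x)\<^sup>2" for w
  have [measurable]: "F \<in> borel_measurable borel" unfolding F_def by measurable
  define c where "c = s / s'"
  have c: "0 < c" "c \<le> 1" and s': "s' * c = s" using assms by (auto simp: c_def)
  have rF: "risk p l t x = (LINT z|lborel. std_normal_density z * F (t * z))" for t
    unfolding risk_def F_def[symmetric] by (rule std_gauss_integral) measurable
  have iF: "integrable lborel (\<lambda>z. std_normal_density z * F (t * z))" for t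
    using risk_integrable[of x t] unfolding F_def[symmetric]
    by (subst (asm) std_gauss_integrable_iff) measurable
  \<comment> \<open>Substituting \<open>c * w\<close> at noise level \<open>s'\<close> gives both
    integrands the same factor \<open>F (s * w)\<close>, so only the Gaussian densities at
    \<open>w\<close> and \<open>c * w\<close> are compared.\<close>
  have le: "risk p l s x \<le> (LINT w|lborel. std_normal_density (c * w) * F (s' * (c * w)))"
    unfolding rF
  proof (rule integral_mono[OF iF])
    show "integrable lborel (\<lambda>w. std_normal_density (c * w) * F (s' * (c * w)))"
      using lborel_integrable_real_affine[OF iF[of s'], of c 0] c by simp
    fix w :: real
    have "(c * w)\<^sup>2 \<le> 1 * w\<^sup>2"
      unfolding power_mult_distrib using c by (intro mult_right_mono) (auto simp: power_le_one)
    then have "std_normal_density w \<le> std_normal_density (c * w)"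
      unfolding std_normal_density_def by (intro mult_left_mono) auto
    then show "std_normal_density w * F (s * w) \<le> std_normal_density (c * w) * F (s' * (c * w))"
      unfolding mult.assoc[symmetric] s' by (rule mult_right_mono) (simp add: F_def)
  qed
  have "risk p l s' x = c * (LINT w|lborel. std_normal_density (c * w) * F (s' * (c * w)))"
    unfolding rF using lborel_integral_real_affine[of c "\<lambda>z. std_normal_density z * F (s' * z)" 0] c
    by simp
  then have "c * risk p l s x \<le> risk p l s' x"
    using mult_left_mono[OF le, of c] c by simp
  then show ?thesis
    using assms by (simp add: c_def field_simps)
qed

text \<open>The penalty \<open>l * s powr (2 - p)\<close> is the one that \<open>eta_scale\<close>
  turns into \<open>l\<close> at unit noise.\<close>

lemma risk_scale:
  assumes "0 < s"
  shows "risk p (l * s powr (2 - p)) s x = s\<^sup>2 * risk p l 1 (x / s)"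
proof -
  have "eta p (x + s * z) (l * s powr (2 - p)) = s * eta p (x / s + 1 * z) l" for z
    using eta_scale[of s p "x / s + z" "l * s powr (2 - p)"] assms
    by (simp add: distrib_left powr_add[symmetric] mult.assoc)
  then have "(eta p (x + s * z) (l * s powr (2 - p)) - x)\<^sup>2
      = s\<^sup>2 * (eta p (x / s + 1 * z) l - x / s)\<^sup>2" for z
    using assms by (simp add: power_mult_distrib[symmetric] right_diff_distrib)
  then show ?thesis by (simp add: risk_def)
qed

end

section \<open>Optimally tuned risk of a sparse law\<close>

locale sparse_law = prob_space PX for PX :: "real measure" +
  assumes sets_PX [measurable_cong, simp]: "sets PX = sets borel"
    and square_integrable: "integrable PX (\<lambda>x. x\<^sup>2)"
begin

lemma space_PX [simp]: "space PX = UNIV"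
  using sets_eq_imp_space_eq[OF sets_PX] by simp

sublocale joint: pair_prob_space PX std_gauss ..

lemma joint_dominating: "integrable (PX \<Otimes>\<^sub>M std_gauss) (\<lambda>xz. (fst xz)\<^sup>2 + s\<^sup>2 * (snd xz)\<^sup>2)"
proof (intro Bochner_Integration.integrable_add integrable_mult_right)
  have "integrable (distr (PX \<Otimes>\<^sub>M std_gauss) PX fst) (\<lambda>x. x\<^sup>2)"
    by (simp add: std_gauss.distr_pair_fst square_integrable)
  then show "integrable (PX \<Otimes>\<^sub>M std_gauss) (\<lambda>xz. (fst xz)\<^sup>2)"
    by (subst (asm) integrable_distr_eq) auto
  interpret swapped: pair_prob_space std_gauss PX ..
  have "integrable (distr (std_gauss \<Otimes>\<^sub>M PX) std_gauss fst) (\<lambda>z. z\<^sup>2)"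
    by (simp add: distr_pair_fst std_gauss_square)
  then have "integrable (std_gauss \<Otimes>\<^sub>M PX) (\<lambda>zx. (fst zx)\<^sup>2)"
    by (subst (asm) integrable_distr_eq) auto
  then show "integrable (PX \<Otimes>\<^sub>M std_gauss) (\<lambda>xz. (snd xz)\<^sup>2)"
    by (drule_tac swapped.integrable_product_swap) (simp add: case_prod_unfold)
qed

lemma amp_risk_nonneg: "0 \<le> amp_risk p PX s l"
  unfolding amp_risk_def by (intro integral_nonneg_AE) auto

lemma amp_risk_bdd_below: "bdd_below (amp_risk p PX s ` {0..})"
  by (rule bdd_belowI2[of _ 0]) (rule amp_risk_nonneg)

context
  fixes p l :: real
  assumes thr: "thresholding p l"
begin

interpretation thresholding p l by (rule thr)

lemma amp_integrable:
  "integrable (PX \<Otimes>\<^sub>M std_gauss) (\<lambda>xz. \<bar>eta p (fst xz + s * snd xz) l - fst xz\<bar>\<^sup>2)"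
proof (rule Bochner_Integration.integrable_bound[OF joint_dominating[of s]])
  show "AE xz in PX \<Otimes>\<^sub>M std_gauss. norm (\<bar>eta p (fst xz + s * snd xz) l - fst xz\<bar>\<^sup>2)
      \<le> norm ((fst xz)\<^sup>2 + s\<^sup>2 * (snd xz)\<^sup>2)"
    using eta_risk_le[of "fst xz" "s * snd xz" for xz] by (auto simp: power_mult_distrib)
qed measurable

lemma amp_risk_eq: "amp_risk p PX s l = (LINT x|PX. risk p l s x)"
  and risk_PX_integrable: "integrable PX (\<lambda>x. risk p l s x)"
  unfolding amp_risk_def risk_def
  using joint.integral_fst'[OF amp_integrable[of s]] joint.integrable_fst'[OF amp_integrable[of s]]
  by simp_all

lemma risk_measurable [measurable]: "(\<lambda>x. risk p l s x) \<in> borel_measurable borel"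
  using risk_PX_integrable[THEN borel_measurable_integrable] by simp

lemma amp_risk_scale_mono:
  assumes "0 < s" "s \<le> s'"
  shows "s * amp_risk p PX s l \<le> s' * amp_risk p PX s' l"
  unfolding amp_risk_eq integral_mult_right_zero[symmetric]
  using risk_scale_mono[OF assms] risk_PX_integrable
  by (intro integral_mono integrable_mult_right) auto

end

text \<open>The infimum in \<open>Psi\<close>, expressed in the standard deviation instead of the
  variance.\<close>

definition opt_risk :: "real \<Rightarrow> real \<Rightarrow> real" where
  "opt_risk p s = (INF l\<in>{0..}. amp_risk p PX s l)"

lemma opt_risk_nonneg: "0 \<le> opt_risk p s"
  unfolding opt_risk_def by (rule cINF_greatest) (auto simp: amp_risk_nonneg)

lemma opt_risk_le: "0 \<le> l \<Longrightarrow> opt_risk p s \<le> amp_risk p PX s l"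
  unfolding opt_risk_def by (rule cINF_lower[OF amp_risk_bdd_below]) auto

context
  fixes p :: real
  assumes p: "0 \<le> p" "p \<le> 1"
begin

lemma thr: "0 \<le> l \<Longrightarrow> thresholding p l"
  using p by unfold_locales

lemma opt_risk_scale_mono:
  assumes "0 < s" "s \<le> s'"
  shows "s * opt_risk p s \<le> s' * opt_risk p s'"
proof -
  have "s / s' * opt_risk p s \<le> opt_risk p s'"
    unfolding opt_risk_def[of p s']
  proof (rule cINF_greatest)
    fix l :: real assume "l \<in> {0..}"
    then have l: "0 \<le> l" by simp
    have "s * opt_risk p s \<le> s * amp_risk p PX s l"
      using opt_risk_le[OF l] assms by (intro mult_left_mono) auto
    also have "\<dots> \<le> s' * amp_risk p PX s' l"
      by (rule amp_risk_scale_mono[OF thr[OF l] assms])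
    finally show "s / s' * opt_risk p s \<le> amp_risk p PX s' l"
      using assms by (simp add: field_simps)
  qed simp
  then show ?thesis using assms by (simp add: field_simps)
qed

text \<open>At each fixed input the estimate is eventually 0 as \<open>l\<close> grows, so the error
  becomes the signal itself.\<close>

lemma amp_risk_at_top: "((\<lambda>l. amp_risk p PX s l) \<longlongrightarrow> (LINT x|PX. x\<^sup>2)) at_top"
proof -
  \<comment> \<open>Replacing \<open>l\<close> by \<open>max 0 l\<close> makes measurability and the
    domination available for every real \<open>l\<close>.\<close>
  have "((\<lambda>l. LINT xz|(PX \<Otimes>\<^sub>M std_gauss). \<bar>eta p (fst xz + s * snd xz) (max 0 l) - fst xz\<bar>\<^sup>2)
      \<longlongrightarrow> (LINT xz|(PX \<Otimes>\<^sub>M std_gauss). (fst xz)\<^sup>2)) at_top"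
  proof (rule integral_dominated_convergence_at_top[OF _ _ joint_dominating[of s]])
    show "(\<lambda>xz. \<bar>eta p (fst xz + s * snd xz) (max 0 l) - fst xz\<bar>\<^sup>2)
        \<in> borel_measurable (PX \<Otimes>\<^sub>M std_gauss)" for l
      by (rule borel_measurable_integrable[OF amp_integrable[OF thr]]) simp
    show "\<forall>\<^sub>F l in at_top. AE xz in PX \<Otimes>\<^sub>M std_gauss.
        norm (\<bar>eta p (fst xz + s * snd xz) (max 0 l) - fst xz\<bar>\<^sup>2)
          \<le> (fst xz)\<^sup>2 + s\<^sup>2 * (snd xz)\<^sup>2"
    proof (intro always_eventually allI AE_I2)
      fix l xz
      show "norm (\<bar>eta p (fst xz + s * snd xz) (max 0 l) - fst xz\<bar>\<^sup>2)
          \<le> (fst xz)\<^sup>2 + s\<^sup>2 * (snd xz)\<^sup>2"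
        using thresholding.eta_risk_le[OF thr[of "max 0 l"], of "fst xz" "s * snd xz"]
        by (simp add: power_mult_distrib)
    qed
    show "AE xz in PX \<Otimes>\<^sub>M std_gauss.
        ((\<lambda>l. \<bar>eta p (fst xz + s * snd xz) (max 0 l) - fst xz\<bar>\<^sup>2) \<longlongrightarrow> (fst xz)\<^sup>2) at_top"
    proof (rule AE_I2, rule tendsto_eventually)
      fix xz :: "real \<times> real"
      show "\<forall>\<^sub>F l in at_top. \<bar>eta p (fst xz + s * snd xz) (max 0 l) - fst xz\<bar>\<^sup>2 = (fst xz)\<^sup>2"
        using eventually_gt_at_top[of "\<bar>fst xz + s * snd xz\<bar> powr (2 - p)"] eventually_ge_at_top[of 0]
      proof eventually_elim
        case (elim l)
        then show ?case
          using thresholding.eta_eq_0[OF thr[of l], of "fst xz + s * snd xz"] by (simp add: max_def)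
      qed
    qed
  qed measurable
  moreover have "\<forall>\<^sub>F l in at_top. (LINT xz|(PX \<Otimes>\<^sub>M std_gauss).
      \<bar>eta p (fst xz + s * snd xz) (max 0 l) - fst xz\<bar>\<^sup>2) = amp_risk p PX s l"
    using eventually_ge_at_top[of 0] by eventually_elim (simp add: amp_risk_def max_def)
  moreover have "(LINT xz|(PX \<Otimes>\<^sub>M std_gauss). (fst xz)\<^sup>2) = (LINT x|PX. x\<^sup>2)"
  proof -
    have "(LINT x|distr (PX \<Otimes>\<^sub>M std_gauss) PX fst. x\<^sup>2) = (LINT xz|(PX \<Otimes>\<^sub>M std_gauss). (fst xz)\<^sup>2)"
      by (rule integral_distr) auto
    then show ?thesis by (simp add: std_gauss.distr_pair_fst)
  qed
  ultimately show ?thesis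
    using Lim_transform_eventually by simp
qed

lemma opt_risk_le_second_moment: "opt_risk p s \<le> (LINT x|PX. x\<^sup>2)"
  by (rule tendsto_lowerbound[OF amp_risk_at_top eventually_mono[OF eventually_ge_at_top[of 0]]])
    (auto intro: opt_risk_le)

lemma opt_risk_scaled:
  assumes "0 < s" "0 \<le> l"
  shows "opt_risk p s \<le> s\<^sup>2 * (LINT x|PX. risk p l 1 (x / s))"
proof -
  have "opt_risk p s \<le> amp_risk p PX s (l * s powr (2 - p))"
    using assms by (intro opt_risk_le) simp
  also have "\<dots> = s\<^sup>2 * (LINT x|PX. risk p l 1 (x / s))"
    using assms
    by (simp add: amp_risk_eq[OF thr] thresholding.risk_scale[OF thr])
  finally show ?thesis .
qed

end

end

section \<open>Fixed points of the state evolution\<close>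

lemma sparse_distsD:
  assumes "PX \<in> sparse_dists \<epsilon>"
  shows "sparse_law PX" "measure PX {x. x \<noteq> 0} \<le> \<epsilon>"
  using assms by (auto simp: sparse_dists_def sparse_law_def sparse_law_axioms_def)

context sparse_law
begin

lemma Psi_square: "0 \<le> s \<Longrightarrow> Psi p \<delta> sw PX (s\<^sup>2) = sw\<^sup>2 + opt_risk p s / \<delta>"
  by (simp add: Psi_def opt_risk_def)

text \<open>The fixed point is the supremum of the points where the map lies on or above the
  diagonal. After multiplication by \<open>s\<close> the risk term is monotone and the rest is a
  cubic, so comparisons from both sides of the supremum replace continuity.\<close>

lemma highest_fixed_point_exists:
  assumes p: "0 \<le> p" "p \<le> 1" and \<delta>: "0 < \<delta>" and sw: "0 < sw"
  obtains sh where "highest_fixed_point p \<delta> sw PX sh" "sw \<le> sh"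
proof -
  define f where "f s = sw\<^sup>2 + opt_risk p s / \<delta>" for s
  define C where "C = sw\<^sup>2 + (LINT x|PX. x\<^sup>2) / \<delta>"
  define S where "S = {s. 0 < s \<and> s\<^sup>2 \<le> f s}"
  define s0 where "s0 = Sup S"
  \<comment> \<open>With these names \<open>s * s\<^sup>2 \<le> s * f s\<close> reads
    \<open>k s \<le> s * opt_risk p s / \<delta>\<close>, and \<open>K\<close> is the right side at
    \<open>s0\<close>.\<close>
  define k where "k s = s * s\<^sup>2 - s * sw\<^sup>2" for s :: real
  define K where "K = s0 * opt_risk p s0 / \<delta>"
  have swS: "sw \<in> S" using sw \<delta> opt_risk_nonneg[of p sw] by (simp add: S_def f_def)
  have bdd: "bdd_above S"
  proof (rule bdd_aboveI)
    fix s assume s: "s \<in> S"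
    then have "s\<^sup>2 \<le> f s" by (simp add: S_def)
    also have "\<dots> \<le> C"
      using opt_risk_le_second_moment[OF p, of s] \<delta> by (simp add: f_def C_def divide_right_mono)
    finally show "s \<le> sqrt C" by (rule real_le_rsqrt)
  qed
  have s0: "sw \<le> s0" "0 < s0"
    using cSup_upper[OF swS bdd] sw by (auto simp: s0_def)
  have K_iff: "f s0 = s0\<^sup>2 \<longleftrightarrow> k s0 = K"
  proof -
    have "k s0 - K = s0 * (s0\<^sup>2 - f s0)" by (simp add: k_def K_def f_def algebra_simps)
    then show ?thesis using s0 by auto
  qed
  have cont: "continuous_on UNIV k" unfolding k_def by (intro continuous_intros)
  \<comment> \<open>From the left: on \<open>S\<close> the inequality holds, monotonicity raises its
    right side to \<open>K\<close>, and the closed set \<open>{s. k s \<le> K}\<close> contains the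
    supremum.\<close>
  have "k s0 \<le> K"
  proof -
    have "closed {s. k s \<le> K}" using cont by (intro closed_Collect_le continuous_intros)
    moreover have "S \<subseteq> {s. k s \<le> K}"
    proof clarify
      fix s assume s: "s \<in> S"
      then have "s \<le> s0" using cSup_upper[OF _ bdd] by (simp add: s0_def)
      then have "s * opt_risk p s / \<delta> \<le> K"
        unfolding K_def using s \<delta> opt_risk_scale_mono[OF p, of s s0]
        by (intro divide_right_mono) (auto simp: S_def)
      moreover have "s * s\<^sup>2 \<le> s * f s" using s by (intro mult_left_mono) (auto simp: S_def)
      ultimately show "k s \<le> K" by (simp add: k_def f_def algebra_simps)
    qed
    ultimately show ?thesis
      using closed_subset_contains_Sup[of "{s. k s \<le> K}" S] swS bdd by (auto simp: s0_def)
  qed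
  \<comment> \<open>From the right: points above \<open>s0\<close> are outside \<open>S\<close>, so
    the inequality is reversed there and survives the limit.\<close>
  moreover have "K \<le> k s0"
  proof (rule tendsto_lowerbound[of k _ "at_right s0"])
    show "(k \<longlongrightarrow> k s0) (at_right s0)"
      using cont by (auto simp: continuous_on_def intro: tendsto_within_subset)
    show "\<forall>\<^sub>F s in at_right s0. K \<le> k s"
    proof (rule eventually_at_right_less[THEN eventually_mono])
      fix s assume s: "s0 < s"
      then have "s \<notin> S" using cSup_upper[OF _ bdd] by (fastforce simp: s0_def)
      then have "s * f s \<le> s * s\<^sup>2" using s s0 by (intro mult_left_mono) (auto simp: S_def)
      moreover have "K \<le> s * opt_risk p s / \<delta>"
        unfolding K_def using s s0 \<delta> opt_risk_scale_mono[OF p, of s0 s]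
        by (intro divide_right_mono) auto
      ultimately show "K \<le> k s" by (simp add: k_def f_def algebra_simps)
    qed
  qed simp
  ultimately have fix0: "f s0 = s0\<^sup>2" using K_iff by simp
  have "highest_fixed_point p \<delta> sw PX s0"
    unfolding highest_fixed_point_def
  proof (intro conjI allI impI)
    show "Psi p \<delta> sw PX (s0\<^sup>2) = s0\<^sup>2" using fix0 s0 by (simp add: Psi_square f_def)
    fix s :: real assume s: "0 \<le> s" "Psi p \<delta> sw PX (s\<^sup>2) = s\<^sup>2"
    then have "s\<^sup>2 = f s" by (simp add: Psi_square f_def)
    \<comment> \<open>Positive noise excludes the fixed point 0, so every fixed point belongs to
      \<open>S\<close>.\<close>
    moreover have "0 < f s"
      using opt_risk_nonneg[of p s] sw \<delta> by (simp add: f_def add_pos_nonneg)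
    ultimately have "s \<in> S" using s by (cases "s = 0") (auto simp: S_def)
    then show "s \<le> s0" using cSup_upper[OF _ bdd] by (simp add: s0_def)
  qed (use s0 in simp)
  then show thesis using that s0 by blast
qed

end

section \<open>Worst-case risk of a sparse law and the upper bound\<close>

lemma two_point_risk_nonneg:
  assumes "0 \<le> \<epsilon>" "\<epsilon> \<le> 1"
  shows "0 \<le> two_point_risk p \<epsilon> \<mu> \<tau>"
  using assms by (simp add: two_point_risk_eq risk_nonneg)

lemma two_point_risk_bdd_above:
  assumes "0 \<le> p" "p \<le> 1" "0 \<le> \<epsilon>" "0 \<le> \<tau>"
  shows "bdd_above ((\<lambda>\<mu>. two_point_risk p \<epsilon> \<mu> \<tau>) ` A)"
proof -
  have "thresholding p \<tau>" using assms by unfold_locales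
  then obtain K where "\<And>x. risk p \<tau> 1 x \<le> K" using thresholding.risk_bounded by blast
  then show ?thesis
    using assms
    by (intro bdd_aboveI2[of _ _ "(1 - \<epsilon>) * risk p \<tau> 1 0 + \<epsilon> * K"])
      (simp add: two_point_risk_eq mult_left_mono)
qed

text \<open>The conditional risk is \<open>r 0\<close> at the origin and at most its supremum
  \<open>K\<close> elsewhere. Since \<open>r 0 \<le> K\<close>, the worst law puts the full mass
  \<open>\<epsilon>\<close> off the origin.\<close>

lemma sparse_risk_le_Sup:
  assumes "0 \<le> p" "p \<le> 1" "0 \<le> \<epsilon>" "\<epsilon> \<le> 1" "0 \<le> \<tau>"
    and PX: "PX \<in> sparse_dists \<epsilon>" and s: "0 < s"
  shows "(LINT x|PX. risk p \<tau> 1 (x / s)) \<le> (SUP \<mu>\<in>{0..}. two_point_risk p \<epsilon> \<mu> \<tau>)"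
proof -
  interpret sparse_law PX using sparse_distsD[OF PX] by simp
  have thr: "thresholding p \<tau>" using assms by unfold_locales
  note [measurable] = risk_measurable[OF thr]
  define r where "r = risk p \<tau> 1"
  define M where "M = (SUP \<mu>\<in>{0..}. two_point_risk p \<epsilon> \<mu> \<tau>)"
  define K where "K = (SUP \<mu>\<in>{0..}. r \<mu>)"
  obtain B where B: "\<And>x. r x \<le> B"
    using thresholding.risk_bounded[OF thr] by (auto simp: r_def)
  have bddr: "bdd_above (r ` {0..})" by (rule bdd_aboveI2[of _ _ B]) (rule B)
  have rK: "r x \<le> K" for x
  proof -
    have "r x = r \<bar>x\<bar>" using thresholding.risk_minus[OF thr, of 1 x] by (simp add: r_def abs_if)
    also have "\<dots> \<le> K" unfolding K_def by (rule cSUP_upper[OF _ bddr]) simp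
    finally show ?thesis .
  qed
  have M: "(1 - \<epsilon>) * r 0 + \<epsilon> * r \<mu> \<le> M" if "0 \<le> \<mu>" for \<mu>
    using cSUP_upper[OF _ two_point_risk_bdd_above[of p \<epsilon> \<tau> "{0..}"], of \<mu>] assms that
    by (simp add: M_def two_point_risk_eq r_def)
  \<comment> \<open>The supremum over the mean passes through the affine map; solving for
    \<open>r \<mu>\<close> divides by \<open>\<epsilon>\<close>, so \<open>\<epsilon> = 0\<close> is
    separate.\<close>
  have MK: "(1 - \<epsilon>) * r 0 + \<epsilon> * K \<le> M"
  proof (cases "\<epsilon> = 0")
    case False
    then have "r \<mu> \<le> (M - (1 - \<epsilon>) * r 0) / \<epsilon>" if "0 \<le> \<mu>" for \<mu>
      using M[OF that] assms(3) by (simp add: field_simps)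
    then have "K \<le> (M - (1 - \<epsilon>) * r 0) / \<epsilon>"
      unfolding K_def by (intro cSUP_least) auto
    then show ?thesis using False assms(3) by (simp add: field_simps)
  qed (use M[of 0] in simp)
  have "(LINT x|PX. r (x / s)) \<le> (LINT x|PX. r 0 + (K - r 0) * indicator {x. x \<noteq> 0} x)"
  proof (rule integral_mono)
    show "integrable PX (\<lambda>x. r (x / s))"
    proof (rule integrable_const_bound[of _ B])
      show "AE x in PX. norm (r (x / s)) \<le> B" using B risk_nonneg[of p \<tau> 1] by (auto simp: r_def)
    qed (simp add: r_def)
    show "r (x / s) \<le> r 0 + (K - r 0) * indicator {x. x \<noteq> 0} x" for x
      using rK[of "x / s"] by (simp add: indicator_def)
  qed (auto simp: less_top[symmetric])
  also have "\<dots> = r 0 + (K - r 0) * measure PX {x. x \<noteq> 0}"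
    by (subst Bochner_Integration.integral_add) (auto simp: less_top[symmetric] prob_space[simplified])
  also have "\<dots> \<le> r 0 + (K - r 0) * \<epsilon>"
    using sparse_distsD[OF PX] rK[of 0] by (intro add_left_mono mult_left_mono) auto
  also have "\<dots> \<le> M" using MK by (simp add: algebra_simps)
  finally show ?thesis by (simp add: r_def M_def)
qed

text \<open>The fixed point equation reads
  \<open>opt_risk p s = \<delta> * (s\<^sup>2 - sw\<^sup>2)\<close>, while scaling to unit noise
  gives \<open>opt_risk p s \<le> M_upper p \<epsilon> * s\<^sup>2\<close>; the rest is
  rearrangement.\<close>

lemma fixed_point_le:
  assumes "0 \<le> p" "p \<le> 1" "0 < \<delta>" "0 \<le> \<epsilon>" "\<epsilon> \<le> 1" "M_upper p \<epsilon> < \<delta>"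
    and PX: "PX \<in> sparse_dists \<epsilon>" and "0 < sw" "0 < s"
    and fixed: "Psi p \<delta> sw PX (s\<^sup>2) = s\<^sup>2"
  shows "s\<^sup>2 / sw\<^sup>2 \<le> 1 / (1 - M_upper p \<epsilon> / \<delta>)"
proof -
  interpret sparse_law PX using sparse_distsD[OF PX] by simp
  have "opt_risk p s / s\<^sup>2 \<le> M_upper p \<epsilon>"
    unfolding M_upper_def
  proof (rule cINF_greatest)
    fix \<tau> :: real assume "\<tau> \<in> {0..}"
    then have \<tau>: "0 \<le> \<tau>" by simp
    have "opt_risk p s / s\<^sup>2 \<le> (LINT x|PX. risk p \<tau> 1 (x / s))"
      using opt_risk_scaled[of p s \<tau>] assms \<tau> by (simp add: field_simps)
    also have "\<dots> \<le> (SUP \<mu>\<in>{0..}. two_point_risk p \<epsilon> \<mu> \<tau>)"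
      using assms \<tau> by (intro sparse_risk_le_Sup) auto
    finally show "opt_risk p s / s\<^sup>2 \<le> (SUP \<mu>\<in>{0..}. two_point_risk p \<epsilon> \<mu> \<tau>)" .
  qed simp
  then have "opt_risk p s \<le> M_upper p \<epsilon> * s\<^sup>2" using assms by (simp add: field_simps)
  moreover have "opt_risk p s = \<delta> * (s\<^sup>2 - sw\<^sup>2)"
    using fixed assms by (simp add: Psi_square field_simps)
  ultimately have "s\<^sup>2 * (\<delta> - M_upper p \<epsilon>) \<le> \<delta> * sw\<^sup>2" by (simp add: algebra_simps)
  moreover have "1 / (1 - M_upper p \<epsilon> / \<delta>) = \<delta> / (\<delta> - M_upper p \<epsilon>)"
    using assms by (simp add: field_simps)
  ultimately show ?thesis using assms by (simp add: field_simps)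
qed

section \<open>Two-point laws and lower bounds for the highest fixed point\<close>

definition two_point_law :: "real \<Rightarrow> real \<Rightarrow> real measure" where
  "two_point_law \<epsilon> \<mu> = distr (measure_pmf (bernoulli_pmf \<epsilon>)) borel (\<lambda>b. if b then \<mu> else 0)"

lemma two_point_law_integral:
  fixes f :: "real \<Rightarrow> real"
  assumes "0 \<le> \<epsilon>" "\<epsilon> \<le> 1" "f \<in> borel_measurable borel"
  shows "(LINT x|two_point_law \<epsilon> \<mu>. f x) = (1 - \<epsilon>) * f 0 + \<epsilon> * f \<mu>"
  using assms unfolding two_point_law_def by (subst integral_distr) auto

lemma two_point_law_sparse:
  assumes "0 \<le> \<epsilon>" "\<epsilon> \<le> 1"
  shows "two_point_law \<epsilon> \<mu> \<in> sparse_dists \<epsilon>"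
proof -
  let ?P = "two_point_law \<epsilon> \<mu>"
  interpret prob_space ?P
    unfolding two_point_law_def by (rule measure_pmf.prob_space_distr) simp
  have "integrable ?P (\<lambda>x. x\<^sup>2)"
    unfolding two_point_law_def
    by (subst integrable_distr_eq) (auto intro!: integrable_measure_pmf_finite)
  moreover have "measure ?P {x. x \<noteq> 0} = (LINT x|?P. indicator {x. x \<noteq> 0} x)"
    by (simp add: two_point_law_def)
  then have "measure ?P {x. x \<noteq> 0} \<le> \<epsilon>"
    using assms by (subst (asm) two_point_law_integral) (auto simp: indicator_def)
  ultimately show ?thesis
    using prob_space_axioms by (simp add: sparse_dists_def two_point_law_def)
qed

text \<open>The function \<open>h\<close> of the introductory comment: the inner infimum of
  \<open>M_lower\<close>.\<close>

definition best_two_point_risk :: "real \<Rightarrow> real \<Rightarrow> real \<Rightarrow> real" where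
  "best_two_point_risk p \<epsilon> \<mu> = (INF \<tau>\<in>{0..}. two_point_risk p \<epsilon> \<mu> \<tau>)"

lemma M_lower_eq: "M_lower p \<epsilon> = (SUP \<mu>\<in>{0..}. best_two_point_risk p \<epsilon> \<mu>)"
  by (simp add: M_lower_def best_two_point_risk_def)

lemma highest_fixed_point_ge:
  assumes "0 \<le> p" "p \<le> 1" "0 < \<delta>" "0 \<le> \<epsilon>" "\<epsilon> \<le> 1"
    and less: "best_two_point_risk p \<epsilon> \<mu> < \<delta>"
  shows "\<exists>PX \<in> sparse_dists \<epsilon>. \<exists>sw > 0. \<exists>sh. highest_fixed_point p \<delta> sw PX sh \<and>
           sh\<^sup>2 / sw\<^sup>2 \<ge> 1 / (1 - best_two_point_risk p \<epsilon> \<mu> / \<delta>)"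
proof -
  define m where "m = best_two_point_risk p \<epsilon> \<mu>"
  define PX where "PX = two_point_law \<epsilon> \<mu>"
  have PX: "PX \<in> sparse_dists \<epsilon>" using two_point_law_sparse assms by (simp add: PX_def)
  interpret sparse_law PX using sparse_distsD[OF PX] by simp
  have m: "m < \<delta>" using less by (simp add: m_def)
  \<comment> \<open>The noise variance solves \<open>sw\<^sup>2 + m / \<delta> = 1\<close>, which
    makes 1 a fixed point; the highest one can only be larger.\<close>
  define sw where "sw = sqrt (1 - m / \<delta>)"
  have sw: "0 < sw" "sw\<^sup>2 = 1 - m / \<delta>" using m assms by (auto simp: sw_def)
  have "amp_risk p PX 1 l = two_point_risk p \<epsilon> \<mu> l" if "0 \<le> l" for l
  proof -
    have thr: "thresholding p l" using assms that by unfold_locales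
    show ?thesis
      using assms unfolding amp_risk_eq[OF thr]
      by (simp add: PX_def two_point_law_integral risk_measurable[OF thr] two_point_risk_eq)
  qed
  then have "opt_risk p 1 = m"
    unfolding opt_risk_def m_def best_two_point_risk_def by (intro INF_cong) auto
  then have "Psi p \<delta> sw PX (1\<^sup>2) = 1\<^sup>2" using sw by (subst Psi_square) auto
  moreover obtain sh where sh: "highest_fixed_point p \<delta> sw PX sh"
    using highest_fixed_point_exists assms sw by metis
  ultimately have "1 \<le> sh" by (auto simp: highest_fixed_point_def)
  then have "1\<^sup>2 / sw\<^sup>2 \<le> sh\<^sup>2 / sw\<^sup>2" by (intro divide_right_mono power_mono) auto
  then have "1 / (1 - m / \<delta>) \<le> sh\<^sup>2 / sw\<^sup>2" using sw by simp
  then show ?thesis using PX sw(1) sh unfolding m_def by blast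
qed

text \<open>A fixed point is never below the noise level, so ratios up to 1 come for free. This
  covers the degenerate case \<open>\<delta> \<le> M_lower p \<epsilon>\<close>.\<close>

lemma highest_fixed_point_ge_1:
  assumes "0 \<le> p" "p \<le> 1" "0 < \<delta>" "0 \<le> \<epsilon>" "\<epsilon> \<le> 1" "c \<le> 1"
  shows "\<exists>PX \<in> sparse_dists \<epsilon>. \<exists>sw > 0. \<exists>sh. highest_fixed_point p \<delta> sw PX sh \<and> sh\<^sup>2 / sw\<^sup>2 \<ge> c"
proof -
  define PX where "PX = two_point_law \<epsilon> 0"
  have PX: "PX \<in> sparse_dists \<epsilon>" using two_point_law_sparse assms by (simp add: PX_def)
  interpret sparse_law PX using sparse_distsD[OF PX] by simp
  obtain sh where sh: "highest_fixed_point p \<delta> 1 PX sh" "1 \<le> sh"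
    using highest_fixed_point_exists[of p \<delta> 1] assms by auto
  have "1 \<le> sh\<^sup>2" using sh(2) by (rule one_le_power)
  then have "c \<le> sh\<^sup>2 / 1\<^sup>2" using assms by simp
  then show ?thesis using PX sh by (metis zero_less_one)
qed

lemma best_two_point_risk_le:
  assumes "0 \<le> \<epsilon>" "\<epsilon> \<le> 1" "0 \<le> \<tau>"
  shows "best_two_point_risk p \<epsilon> \<mu> \<le> two_point_risk p \<epsilon> \<mu> \<tau>"
  unfolding best_two_point_risk_def
  using two_point_risk_nonneg assms by (intro cINF_lower bdd_belowI2) auto

text \<open>The infimum is at most the value at \<open>\<tau> = 0\<close>, which is bounded in the
  mean; the supremum in \<open>M_lower\<close> is therefore genuine.\<close>

lemma best_two_point_risk_bdd_above:
  assumes "0 \<le> p" "p \<le> 1" "0 \<le> \<epsilon>" "\<epsilon> \<le> 1"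
  shows "bdd_above (best_two_point_risk p \<epsilon> ` A)"
proof -
  obtain K where K: "\<And>\<mu>. \<mu> \<in> A \<Longrightarrow> two_point_risk p \<epsilon> \<mu> 0 \<le> K"
    using two_point_risk_bdd_above[of p \<epsilon> 0 A] assms by (auto simp: bdd_above_def)
  then show ?thesis
    using order_trans[OF best_two_point_risk_le[of \<epsilon> 0 p] K] assms by (auto intro!: bdd_aboveI2)
qed

section \<open>Shrinkage and excess risk\<close>

text \<open>The negated density is an antiderivative of \<open>z * std_normal_density z\<close> and
  vanishes at infinity.\<close>

lemma gauss_tail:
  fixes k :: real
  defines "h \<equiv> \<lambda>z::real. indicator {k<..} z * (z * std_normal_density z)"
  shows "integrable lborel h" "(LINT z|lborel. h z) = std_normal_density k"
proof -
  have int: "integrable lborel (\<lambda>z. z * std_normal_density z)"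
    using integrable_std_normal_moment[of 1] by (simp add: mult.commute)
  show "integrable lborel h"
    unfolding h_def using integrable_mult_indicator[OF _ int, of "{k<..}"] by simp
  have "(LBINT z=ereal k..\<infinity>. z * std_normal_density z) = 0 - (- std_normal_density k)"
  proof (rule interval_integral_FTC_integrable[where F = "\<lambda>z. - std_normal_density z"])
    have "((\<lambda>z. - (c * exp (- z\<^sup>2 / 2))) has_real_derivative z * (c * exp (- z\<^sup>2 / 2))) (at z)"
      for z c :: real
      by (auto intro!: derivative_eq_intros)
    then show "((\<lambda>z. - std_normal_density z) has_vector_derivative z * std_normal_density z) (at z)" for z
      unfolding std_normal_density_def has_real_derivative_iff_has_vector_derivative[symmetric] .
    show "isCont (\<lambda>z. z * std_normal_density z) z" for z
      unfolding std_normal_density_def by (intro continuous_intros) auto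
    show "set_integrable lborel (einterval (ereal k) \<infinity>) (\<lambda>z. z * std_normal_density z)"
      unfolding set_integrable_def by (rule integrable_mult_indicator[OF _ int]) auto
    have "((\<lambda>z. - std_normal_density z) \<longlongrightarrow> - std_normal_density k) (at_right k)"
      unfolding std_normal_density_def by (intro tendsto_intros) auto
    then show "(((\<lambda>z. - std_normal_density z) \<circ> real_of_ereal) \<longlongrightarrow> - std_normal_density k) (at_right (ereal k))"
      by (simp add: ereal_tendsto_simps)
    have "((\<lambda>z. - std_normal_density z) \<longlongrightarrow> 0) at_top"
      unfolding std_normal_density_def by real_asymp
    then show "(((\<lambda>z. - std_normal_density z) \<circ> real_of_ereal) \<longlongrightarrow> 0) (at_left \<infinity>)"
      by (simp add: ereal_tendsto_simps)
  qed simp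
  then show "(LINT z|lborel. h z) = std_normal_density k"
    by (simp add: interval_lebesgue_integral_def set_lebesgue_integral_def einterval_def h_def
        greaterThan_def)
qed

context thresholding
begin

definition shrinkage :: "real \<Rightarrow> real" where
  "shrinkage u = u - eta p u l"

lemma shrinkage_measurable [measurable]: "shrinkage \<in> borel_measurable borel"
  unfolding shrinkage_def by measurable

lemma shrinkage_minus: "shrinkage (- u) = - shrinkage u"
  by (simp add: shrinkage_def eta_minus)

lemma shrinkage_range:
  assumes "0 \<le> u"
  shows "0 \<le> shrinkage u" "shrinkage u \<le> u"
  using eta_range[OF assms] by (auto simp: shrinkage_def)

lemma shrinkage_abs_le: "\<bar>shrinkage u\<bar> \<le> max 1 (2 * l)"
  using eta_shrinkage_bounded by (simp add: shrinkage_def)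

lemma shrinkage_eq:
  assumes "0 < eta p u l"
  shows "shrinkage u = p * l * eta p u l powr (p - 1)"
  using eta_stationary[OF assms] assms by (simp add: shrinkage_def powr_diff field_simps)

lemma shrinkage_antimono:
  assumes "0 < eta p u l" "u \<le> v"
  shows "shrinkage v \<le> shrinkage u"
proof -
  have "eta p u l \<le> eta p v l" using assms(2) by (rule monoD[OF eta_mono])
  then show ?thesis
    using assms p l by (auto simp: shrinkage_eq intro!: mult_left_mono powr_mono2')
qed

text \<open>Where the estimate is positive, the shrinkage is a constant times its power
  \<open>p - 1\<close>; so it suffices that the ratio of the estimates is at most
  \<open>u / v\<close>.\<close>

lemma shrinkage_decay:
  assumes "0 < eta p u l" "0 < u" "u \<le> v"
  shows "shrinkage v \<le> (u / v) powr (1 - p) * shrinkage u"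
proof -
  define x y where "x = eta p u l" and "y = eta p v l"
  have x: "0 < x" "x \<le> u" using eta_range[of u] assms by (auto simp: x_def)
  \<comment> \<open>Shrinkage does not increase, so the estimate grows at least as fast as the
    input.\<close>
  have "x + (v - u) \<le> y"
    using shrinkage_antimono[OF assms(1,3)] by (simp add: shrinkage_def x_def y_def)
  then have y: "0 < y" "x * v \<le> u * y"
  proof -
    assume *: "x + (v - u) \<le> y"
    then show "0 < y" using x assms by simp
    have "x * (v - u) \<le> u * (v - u)" using x assms by (intro mult_right_mono) auto
    then have "x * v \<le> u * (x + (v - u))" by (simp add: algebra_simps)
    also have "\<dots> \<le> u * y" using * assms by (intro mult_left_mono) auto
    finally show "x * v \<le> u * y" .
  qed
  have "shrinkage v = p * l * y powr (p - 1)" using y by (simp add: shrinkage_eq y_def)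
  also have "y powr (p - 1) = (x / y) powr (1 - p) * x powr (p - 1)"
    using x y by (simp add: powr_divide powr_diff field_simps)
  also have "p * l * \<dots> = (x / y) powr (1 - p) * shrinkage u"
    using x by (simp add: shrinkage_eq x_def)
  also have "\<dots> \<le> (u / v) powr (1 - p) * shrinkage u"
    using x y assms p shrinkage_range[of u]
    by (intro mult_right_mono powr_mono2) (auto simp: field_simps)
  finally show ?thesis .
qed

lemma shrinkage_le_of_eta_pos:
  assumes "0 \<le> u" "0 < eta p u l"
  shows "(2 - p) * shrinkage u \<le> p * u"
  using minimizer_shrinkage_le[OF p(1) l assms(1) eta_minimizer[OF p l]] assms by (simp add: shrinkage_def)

lemma risk_eq_shrinkage: "risk p l 1 x = (LINT z|std_gauss. (z - shrinkage (x + z))\<^sup>2)"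
  by (simp add: risk_def shrinkage_def power2_commute)

lemma shrinkage_integrable:
  "integrable std_gauss (\<lambda>z. (shrinkage (x + z))\<^sup>2)"
  "integrable std_gauss (\<lambda>z. z * shrinkage (x + z))"
proof -
  define B where "B = max 1 (2 * l)"
  have B: "\<bar>shrinkage u\<bar> \<le> B" for u using shrinkage_abs_le by (simp add: B_def)
  show "integrable std_gauss (\<lambda>z. (shrinkage (x + z))\<^sup>2)"
  proof (rule std_gauss.integrable_const_bound[of _ "B\<^sup>2"])
    show "AE z in std_gauss. norm ((shrinkage (x + z))\<^sup>2) \<le> B\<^sup>2"
      using power_mono[OF B abs_ge_zero, of _ 2] by simp
  qed measurable
  show "integrable std_gauss (\<lambda>z. z * shrinkage (x + z))"
  proof (rule Bochner_Integration.integrable_bound)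
    show "integrable std_gauss (\<lambda>z. B * \<bar>z\<bar>)" using std_gauss_ident by auto
    show "AE z in std_gauss. norm (z * shrinkage (x + z)) \<le> norm (B * \<bar>z\<bar>)"
      using mult_left_mono[OF B abs_ge_zero] B[THEN order_trans[OF abs_ge_zero]]
      by (auto simp: abs_mult mult_ac)
  qed measurable
qed

text \<open>The value 1 is the risk of the identity estimator; the integral is the excess caused by
  shrinking.\<close>

lemma risk_excess:
  "risk p l 1 x = 1 + (LINT z|std_gauss. (shrinkage (x + z))\<^sup>2 - 2 * (z * shrinkage (x + z)))"
proof -
  have "risk p l 1 x
      = (LINT z|std_gauss. z\<^sup>2 + ((shrinkage (x + z))\<^sup>2 - 2 * (z * shrinkage (x + z))))"
    unfolding risk_eq_shrinkage by (simp add: power2_eq_square algebra_simps)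
  also have "\<dots> = 1 + (LINT z|std_gauss. (shrinkage (x + z))\<^sup>2 - 2 * (z * shrinkage (x + z)))"
    using std_gauss_square shrinkage_integrable
    by (subst Bochner_Integration.integral_add) auto
  finally show ?thesis .
qed

text \<open>Inputs between 0 and \<open>m - 1\<close> are estimated as 0, so a noise value in
  \<open>[-2, -1]\<close> costs almost all of \<open>m\<close>, and such values have a fixed
  positive probability.\<close>

lemma risk_ge_1_if_eta_0:
  assumes "2 \<le> m" "eta p (m - 1) l = 0" "4 \<le> (m - 2)\<^sup>2 * std_normal_density 2"
  shows "1 \<le> risk p l 1 m"
proof -
  have "4 \<le> (LINT z|lborel. indicator {-2..-1::real} z * ((m - 2)\<^sup>2 * std_normal_density 2))"
    using assms(3) by simp
  also have "\<dots> \<le> (LINT z|lborel. std_normal_density z * (shrinkage (m + z))\<^sup>2)"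
  proof (rule integral_mono)
    show "integrable lborel (\<lambda>z. std_normal_density z * (shrinkage (m + z))\<^sup>2)"
      using shrinkage_integrable(1)[of m] by (subst (asm) std_gauss_integrable_iff) auto
    fix z :: real
    show "indicator {-2..-1} z * ((m - 2)\<^sup>2 * std_normal_density 2)
        \<le> std_normal_density z * (shrinkage (m + z))\<^sup>2"
    proof (cases "z \<in> {-2..-1}")
      case True
      then have z: "- 2 \<le> z" "z \<le> -1" by auto
      then have "eta p (m + z) l \<le> eta p (m - 1) l" by (intro monoD[OF eta_mono]) simp
      then have "shrinkage (m + z) = m + z"
        using eta_range[of "m + z"] z assms by (simp add: shrinkage_def)
      moreover have "(m - 2)\<^sup>2 \<le> (m + z)\<^sup>2" using z assms by (intro power_mono) auto
      moreover have "z\<^sup>2 \<le> 2\<^sup>2" using z by (subst abs_le_square_iff[symmetric]) auto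
      then have "std_normal_density 2 \<le> std_normal_density z"
        unfolding std_normal_density_def by (intro mult_left_mono) auto
      ultimately show ?thesis
        using True by (simp add: mult.commute[of "(m - 2)\<^sup>2"] mult_mono)
    qed simp
  qed simp
  also have "\<dots> = (LINT z|std_gauss. (shrinkage (m + z))\<^sup>2)"
    by (simp add: std_gauss_integral)
  finally have D: "4 \<le> (LINT z|std_gauss. (shrinkage (m + z))\<^sup>2)" .
  \<comment> \<open>Young's inequality bounds \<open>2 * z * G\<close> by
    \<open>G\<^sup>2 / 2 + 2 * z\<^sup>2\<close>; the constant 4 balances the noise term of mean
    2.\<close>
  have "0 \<le> (LINT z|std_gauss. (shrinkage (m + z))\<^sup>2) / 2 - 2 * (LINT z|std_gauss. z\<^sup>2)"
    using D std_gauss_square by simp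
  also have "\<dots> = (LINT z|std_gauss. (shrinkage (m + z))\<^sup>2 / 2 - 2 * z\<^sup>2)"
    using shrinkage_integrable std_gauss_square by simp
  also have "\<dots> \<le> (LINT z|std_gauss. (shrinkage (m + z))\<^sup>2 - 2 * (z * shrinkage (m + z)))"
  proof (rule integral_mono)
    fix z
    have "0 \<le> (shrinkage (m + z) - 2 * z)\<^sup>2 / 2" by simp
    then show "(shrinkage (m + z))\<^sup>2 / 2 - 2 * z\<^sup>2
        \<le> (shrinkage (m + z))\<^sup>2 - 2 * (z * shrinkage (m + z))"
      by (simp add: power2_eq_square field_simps)
  qed (use shrinkage_integrable std_gauss_square in auto)
  finally show ?thesis by (simp add: risk_excess)
qed

end

section \<open>Excess risk when the estimate at \<open>m - 1\<close> is positive\<close>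

lemma gauss_tail_shift:
  fixes m k :: real
  defines "h \<equiv> \<lambda>y. indicator {k<..} y * ((y - m) * std_normal_density (y - m))"
  shows "integrable lborel h" "(LINT y|lborel. h y) = std_normal_density (k - m)"
proof -
  define g where "g z = indicator {k - m<..} z * (z * std_normal_density z)" for z :: real
  have h: "h = (\<lambda>y. g (- m + 1 * y))"
    by (auto simp: h_def g_def indicator_def fun_eq_iff)
  show "integrable lborel h"
    unfolding h using gauss_tail(1)[of "k - m"]
    by (intro lborel_integrable_real_affine) (simp_all add: g_def[abs_def])
  show "(LINT y|lborel. h y) = std_normal_density (k - m)"
    using lborel_integral_real_affine[of 1 g "- m"] gauss_tail(2)[of "k - m"]
    by (simp add: h g_def)
qed

text \<open>This says that \<open>std_normal_density (y - m) + std_normal_density (y + m)\<close>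
  increases up to \<open>m - 1\<close>. The two densities have ratio \<open>exp (2 * m * y)\<close>,
  and \<open>m * (m - y) \<ge> 1\<close>.\<close>

lemma gauss_slope_nonneg:
  assumes "0 \<le> y" "y \<le> m - 1" "1 \<le> m"
  shows "(y + m) * std_normal_density (y + m) \<le> (m - y) * std_normal_density (y - m)"
proof -
  have "y + m \<le> (m - y) * (1 + 2 * m * y)"
  proof -
    have "1 * 1 \<le> m * (m - y)" using assms by (intro mult_mono) auto
    then have "y * (2 * 1) \<le> y * (2 * (m * (m - y)))"
      using assms by (intro mult_left_mono) auto
    then show ?thesis by (simp add: algebra_simps)
  qed
  also have "\<dots> \<le> (m - y) * exp (2 * m * y)"
    using assms by (intro mult_left_mono exp_ge_add_one_self) auto
  finally have "(y + m) * std_normal_density (y + m)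
      \<le> (m - y) * exp (2 * m * y) * std_normal_density (y + m)"
    by (rule mult_right_mono) simp
  also have "\<dots> = (m - y) * std_normal_density (y - m)"
    by (simp add: std_normal_density_def exp_add[symmetric] power2_eq_square field_simps)
  finally show ?thesis .
qed

context thresholding
begin

text \<open>Folding the excess risk onto the half line gives
  \<open>\<integral>\<^bsub>y > 0\<^esub> (w G\<^sup>2 + 2 G w')\<close> with \<open>G\<close> the shrinkage and \<open>w y = \<phi> (y - m) + \<phi> (y + m)\<close>.
  Here \<open>w' \<ge> 0\<close> up to \<open>b = m - 1\<close>, and past \<open>b\<close> the decay of \<open>G\<close> (which needs \<open>p < 1\<close>) makes the
  negative part of \<open>w'\<close> harmless.\<close>

lemma risk_ge_1_if_eta_pos:
  fixes m :: real
  defines "b \<equiv> m - 1"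
  defines "a \<equiv> b / (2 - p)"
  assumes m: "1 < m" and pos: "0 < eta p b l"
    and large: "std_normal_density (a - m) + std_normal_density (a + m)
      \<le> (1 - (b / m) powr (1 - p)) * std_normal_density 1"
  shows "1 \<le> risk p l 1 m"
proof -
  \<comment> \<open>The derivative of the folded weight is \<open>A - B\<close>.\<close>
  define A where "A y = (m - y) * std_normal_density (y - m)" for y
  define B where "B y = (y + m) * std_normal_density (y + m)" for y
  define Gb Gm where "Gb = shrinkage b" and "Gm = shrinkage m"
  define f where "f y = std_normal_density (y - m) * ((shrinkage y)\<^sup>2 + 2 * (m - y) * shrinkage y)" for y
  \<comment> \<open>For \<open>y \<ge> 0\<close>, \<open>L\<close> is a minorant of
    \<open>G * (A - B)\<close> with an explicit integral: 0 up to \<open>a\<close>,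
    \<open>Gb * (A - B)\<close> up to \<open>b\<close>, and \<open>Gm * A - Gb * B\<close> beyond
    \<open>b\<close>.\<close>
  define L where "L y = Gb * (indicator {a<..} y * A y) + (Gm - Gb) * (indicator {b<..} y * A y)
    - Gb * (indicator {a<..} y * B y)" for y
  have b: "0 < b" "b < m" using m by (auto simp: b_def)
  have a: "0 < a" "a \<le> b" using b p by (auto simp: a_def field_simps)
  \<comment> \<open>This is what \<open>a\<close> is for: an input above \<open>a\<close> that is
    estimated as 0 has shrinkage larger than \<open>Gb\<close>.\<close>
  have Gb: "0 \<le> Gb" "Gb \<le> a"
  proof -
    show "0 \<le> Gb" using shrinkage_range b by (simp add: Gb_def)
    have "(2 - p) * Gb \<le> p * b" using shrinkage_le_of_eta_pos b pos by (simp add: Gb_def)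
    also have "\<dots> \<le> 1 * b" using b p by (intro mult_right_mono) auto
    finally show "Gb \<le> a" using p by (simp add: a_def field_simps)
  qed
  have eta_pos: "0 < eta p y l" if "b \<le> y" for y
    using monoD[OF eta_mono that] pos by simp
  have Gm: "Gm \<le> (b / m) powr (1 - p) * Gb"
    unfolding Gm_def Gb_def using shrinkage_decay[OF pos] b by simp
  have sym: "f (- y) = std_normal_density (y + m) * ((shrinkage y)\<^sup>2 - 2 * (y + m) * shrinkage y)" for y
    by (simp add: f_def shrinkage_minus std_normal_density_def power2_eq_square algebra_simps)
  have fold: "2 * (L y + L (- y)) \<le> f y + f (- y)" if y: "0 \<le> y" for y
  proof -
    define G where "G = shrinkage y"
    have G: "0 \<le> G" using shrinkage_range y by (simp add: G_def)
    have "L (- y) = 0" using a b y by (simp add: L_def)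
    have B0: "0 \<le> B y" using y b by (simp add: B_def)
    have "f y + f (- y) = (std_normal_density (y - m) + std_normal_density (y + m)) * G\<^sup>2
        + 2 * (G * A y - G * B y)"
      unfolding sym by (simp add: f_def A_def B_def G_def algebra_simps)
    then have "2 * (G * A y - G * B y) \<le> f y + f (- y)" by simp
    moreover have "L y \<le> G * A y - G * B y"
    proof (cases "y \<le> b")
      case True
      then have AB: "B y \<le> A y"
        using gauss_slope_nonneg[of y m] y m by (simp add: A_def B_def b_def)
      show ?thesis
      proof (cases "y \<le> a")
        case True
        then show ?thesis using AB G \<open>y \<le> b\<close> by (simp add: L_def mult_left_mono)
      next
        case False
        have "Gb \<le> G"
        proof (cases "eta p y l = 0")
          case True
          then show ?thesis using False Gb by (simp add: G_def shrinkage_def)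
        next
          case F: False
          then have "0 < eta p y l" using eta_range y by (simp add: less_le)
          then show ?thesis
            using shrinkage_antimono[of y b] \<open>y \<le> b\<close> by (simp add: G_def Gb_def)
        qed
        then have "Gb * (A y - B y) \<le> G * (A y - B y)" using AB by (intro mult_right_mono) auto
        then show ?thesis using False \<open>y \<le> b\<close> by (simp add: L_def algebra_simps)
      qed
    next
      case False
      then have "G \<le> Gb" using shrinkage_antimono[OF pos, of y] by (simp add: G_def Gb_def)
      then have "G * B y \<le> Gb * B y" using B0 by (rule mult_right_mono)
      \<comment> \<open>The sign of \<open>A\<close> and the order of \<open>G\<close> and
        \<open>Gm\<close> both switch at \<open>m\<close>, so the product inequality holds on both
        sides.\<close>
      moreover have "Gm * A y \<le> G * A y"
      proof (cases "y \<le> m")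
        case True
        then show ?thesis
          using False shrinkage_antimono[OF eta_pos, of y m]
          by (intro mult_right_mono) (auto simp: A_def G_def Gm_def)
      next
        case F: False
        then show ?thesis
          using b shrinkage_antimono[OF eta_pos, of m y]
          by (intro mult_right_mono_neg) (auto simp: A_def G_def Gm_def mult_nonpos_nonneg)
      qed
      ultimately show ?thesis using False a by (simp add: L_def algebra_simps)
    qed
    ultimately show ?thesis using \<open>L (- y) = 0\<close> by simp
  qed
  have intA: "integrable lborel (\<lambda>y. indicator {k<..} y * A y)"
    and LA: "(LINT y|lborel. indicator {k<..} y * A y) = - std_normal_density (k - m)" for k
  proof -
    have eq: "indicator {k<..} y * A y
        = - (indicator {k<..} y * ((y - m) * std_normal_density (y - m)))" for y
      by (simp add: A_def algebra_simps)
    show "integrable lborel (\<lambda>y. indicator {k<..} y * A y)"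
      unfolding eq using gauss_tail_shift(1)[of k m] by (intro integrable_minus) simp
    show "(LINT y|lborel. indicator {k<..} y * A y) = - std_normal_density (k - m)"
      unfolding eq using gauss_tail_shift(2)[of k m] by simp
  qed
  have intB: "integrable lborel (\<lambda>y. indicator {k<..} y * B y)"
    and LB: "(LINT y|lborel. indicator {k<..} y * B y) = std_normal_density (k + m)" for k
    using gauss_tail_shift[of k "- m"] by (simp_all add: B_def)
  have intL: "integrable lborel L"
    unfolding L_def by (intro Bochner_Integration.integrable_add Bochner_Integration.integrable_diff
        integrable_mult_right intA intB)
  have "(LINT y|lborel. L y) = - Gb * std_normal_density (a - m)
      - (Gm - Gb) * std_normal_density (b - m) - Gb * std_normal_density (a + m)"
    unfolding L_def using intA intB by (simp add: LA LB)
  also have "std_normal_density (b - m) = std_normal_density 1"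
    by (simp add: b_def std_normal_density_def)
  also have "- Gb * std_normal_density (a - m) - (Gm - Gb) * std_normal_density 1
      - Gb * std_normal_density (a + m) = Gb * std_normal_density 1 - Gm * std_normal_density 1
      - Gb * (std_normal_density (a - m) + std_normal_density (a + m))"
    by (simp add: algebra_simps)
  finally have L: "(LINT y|lborel. L y) = \<dots>" .
  \<comment> \<open>The decay bound leaves at least \<open>(1 - (b / m) powr (1 - p)) * Gb\<close>
    in \<open>Gb - Gm\<close>, and the assumption \<open>large\<close> lets this pay for the
    boundary terms at \<open>a\<close>.\<close>
  have "0 \<le> (LINT y|lborel. L y)"
  proof -
    have "Gb * (std_normal_density (a - m) + std_normal_density (a + m))
        \<le> Gb * ((1 - (b / m) powr (1 - p)) * std_normal_density 1)"
      using large Gb by (intro mult_left_mono)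
    moreover have "Gm * std_normal_density 1 \<le> (b / m) powr (1 - p) * Gb * std_normal_density 1"
      using Gm by (rule mult_right_mono) simp
    ultimately show ?thesis unfolding L by (simp add: algebra_simps)
  qed
  define g where "g z = std_normal_density z * ((shrinkage (m + z))\<^sup>2 - 2 * (z * shrinkage (m + z)))" for z
  have gf: "g = (\<lambda>z. f (m + 1 * z))"
    by (auto simp: g_def f_def algebra_simps)
  have intg: "integrable lborel g"
    unfolding g_def using shrinkage_integrable[of m]
    by (subst std_gauss_integrable_iff[symmetric]) (auto intro!: Bochner_Integration.integrable_diff)
  have intf: "integrable lborel f"
    using lborel_integrable_real_affine[OF intg, of 1 "- m"] by (simp add: gf)
  have "risk p l 1 m - 1 = (LINT z|lborel. g z)"
    unfolding risk_excess g_def by (simp add: std_gauss_integral)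
  also have "\<dots> = (LINT y|lborel. f y)"
    using lborel_integral_real_affine[of 1 f m] by (simp add: gf)
  finally have excess: "risk p l 1 m - 1 = (LINT y|lborel. f y)" .
  have refl: "(LINT y|lborel. h (- y)) = (LINT y|lborel. h y)"
    "integrable lborel h \<Longrightarrow> integrable lborel (\<lambda>y. h (- y))" for h :: "real \<Rightarrow> real"
    using lborel_integral_real_affine[of "-1" h 0] lborel_integrable_real_affine[of h "-1" 0] by auto
  \<comment> \<open>Folding is done by adding the reflected integrand over the whole line, which
    doubles both integrals.\<close>
  have "2 * ((LINT y|lborel. L y) + (LINT y|lborel. L (- y)))
      = (LINT y|lborel. 2 * (L y + L (- y)))"
    using intL refl(2)[OF intL] by simp
  also have "\<dots> \<le> (LINT y|lborel. f y + f (- y))"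
  proof (rule integral_mono)
    show "2 * (L y + L (- y)) \<le> f y + f (- y)" for y
      using fold[of y] fold[of "- y"] by (cases "0 \<le> y") auto
  qed (use intL intf refl(2) in auto)
  also have "\<dots> = 2 * (LINT y|lborel. f y)"
    using intf refl(2)[OF intf] by (simp add: refl(1))
  finally show ?thesis using excess \<open>0 \<le> (LINT y|lborel. L y)\<close> by (simp add: refl(1))
qed

end

text \<open>The threshold on \<open>m\<close> is uniform in \<open>l\<close>: whether the estimate
  at \<open>m - 1\<close> is zero or positive, the size condition involves only \<open>m\<close> and
  \<open>p\<close>.\<close>

lemma eventually_risk_ge_1:
  assumes "0 \<le> p" "p < 1"
  shows "\<forall>\<^sub>F m in at_top. \<forall>l\<ge>0. 1 \<le> risk p l 1 m"
proof -
  define q r where "q = 1 - p" and "r = 1 - 1 / (2 - p)"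
  have qr: "0 < q" "0 < r" "r \<le> 1" using assms by (auto simp: q_def r_def)
  \<comment> \<open>The left side is Gaussian in \<open>m\<close> because \<open>r > 0\<close>,
    while the right side decays only like \<open>1 / m\<close> because \<open>q > 0\<close>. The
    factor 2 absorbs the smaller density at \<open>a + m\<close>.\<close>
  have "\<forall>\<^sub>F m in at_top. 2 * exp (- (r * m + (1 - r))\<^sup>2 / 2)
      \<le> exp (- 1 / 2) * (1 - ((m - 1) / m) powr q)"
    using qr by real_asymp
  moreover have "\<forall>\<^sub>F m in at_top. 4 \<le> (m - 2)\<^sup>2 * std_normal_density 2"
    unfolding std_normal_density_def by real_asymp
  ultimately show ?thesis using eventually_ge_at_top[of "2::real"]
  proof eventually_elim
    case (elim m)
    define a where "a = (m - 1) / (2 - p)"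
    have am: "m - a = r * m + (1 - r)" by (simp add: a_def r_def algebra_simps diff_divide_distrib)
    have "0 \<le> a" using elim assms by (simp add: a_def)
    moreover have "0 \<le> r * m" using qr elim by simp
    ultimately have "\<bar>m - a\<bar> \<le> \<bar>a + m\<bar>" using qr am by simp
    then have "exp (- (a + m)\<^sup>2 / 2) \<le> exp (- (m - a)\<^sup>2 / 2)" by (simp add: abs_le_square_iff)
    then have "exp (- (a - m)\<^sup>2 / 2) + exp (- (a + m)\<^sup>2 / 2)
        \<le> exp (- 1 / 2) * (1 - ((m - 1) / m) powr q)"
      using elim(1) unfolding am[symmetric] power2_commute[of m a] by linarith
    then have "std_normal_density (a - m) + std_normal_density (a + m)
        \<le> (1 - ((m - 1) / m) powr (1 - p)) * std_normal_density 1"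
      unfolding std_normal_density_def q_def
      by (simp add: add_divide_distrib[symmetric] divide_right_mono mult.commute)
    then have large: "std_normal_density ((m - 1) / (2 - p) - m) + std_normal_density ((m - 1) / (2 - p) + m)
        \<le> (1 - ((m - 1) / m) powr (1 - p)) * std_normal_density 1"
      by (simp only: a_def)
    show ?case
    proof (intro allI impI)
      fix l :: real assume "0 \<le> l"
      then interpret thresholding p l using assms by unfold_locales auto
      show "1 \<le> risk p l 1 m"
      proof (cases "eta p (m - 1) l = 0")
        case True
        then show ?thesis using elim risk_ge_1_if_eta_0 by blast
      next
        case False
        then have "0 < eta p (m - 1) l" using eta_range[of "m - 1"] elim by (simp add: less_le)
        then show ?thesis using risk_ge_1_if_eta_pos[of m] large elim by simp
      qed
    qed
  qed
qed

section \<open>Attainment of the lower minimax risk\<close>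

context thresholding
begin

lemma shrinkage_risk_bound:
  "norm ((z - shrinkage u)\<^sup>2) \<le> 2 * z\<^sup>2 + 2 * (max 1 (2 * l))\<^sup>2"
proof -
  have "(shrinkage u)\<^sup>2 \<le> (max 1 (2 * l))\<^sup>2"
    using power_mono[OF shrinkage_abs_le abs_ge_zero, of u 2] by simp
  moreover have "(z - shrinkage u)\<^sup>2 + (z + shrinkage u)\<^sup>2 = 2 * z\<^sup>2 + 2 * (shrinkage u)\<^sup>2"
    by (simp add: power2_eq_square algebra_simps)
  ultimately show ?thesis using zero_le_power2[of "z + shrinkage u"]
    unfolding real_norm_def abs_power2 by linarith
qed

lemma shrinkage_risk_bound_integrable:
  "integrable std_gauss (\<lambda>z. 2 * z\<^sup>2 + 2 * (max 1 (2 * l))\<^sup>2)"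
  using std_gauss_square by (intro Bochner_Integration.integrable_add) auto

lemma shrinkage_at_top:
  assumes "p < 1"
  shows "(shrinkage \<longlongrightarrow> 0) at_top"
proof -
  \<comment> \<open>This input exceeds the shrinkage bound, so its estimate is positive and the
    power decay starts there.\<close>
  define u where "u = max 1 (2 * l) + 1"
  have u: "0 < u" by (simp add: u_def)
  have "eta p u l \<noteq> 0"
    using shrinkage_abs_le[of u] by (auto simp: shrinkage_def u_def)
  then have pos: "0 < eta p u l" using eta_range[of u] u by (simp add: less_le)
  have "((\<lambda>v. (u / v) powr (1 - p) * shrinkage u) \<longlongrightarrow> 0 powr (1 - p) * shrinkage u) at_top"
    using assms u
    by (intro tendsto_mult tendsto_const tendsto_powr2 tendsto_divide_0[OF tendsto_const]
        filterlim_at_top_imp_at_infinity filterlim_ident eventually_mono[OF eventually_ge_at_top[of 0]]) auto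
  then have lim: "((\<lambda>v. (u / v) powr (1 - p) * shrinkage u) \<longlongrightarrow> 0) at_top" by simp
  show ?thesis
  proof (rule tendsto_sandwich[OF _ _ tendsto_const lim])
    show "\<forall>\<^sub>F v in at_top. 0 \<le> shrinkage v"
      using eventually_ge_at_top[of 0] by eventually_elim (rule shrinkage_range)
    show "\<forall>\<^sub>F v in at_top. shrinkage v \<le> (u / v) powr (1 - p) * shrinkage u"
      using eventually_ge_at_top[of u] by eventually_elim (rule shrinkage_decay[OF pos u])
  qed
qed

lemma risk_at_top:
  assumes "p < 1"
  shows "(risk p l 1 \<longlongrightarrow> 1) at_top"
proof -
  have "((\<lambda>x. LINT z|std_gauss. (z - shrinkage (x + z))\<^sup>2) \<longlongrightarrow> (LINT z|std_gauss. z\<^sup>2)) at_top"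
  proof (rule integral_dominated_convergence_at_top[OF _ _ shrinkage_risk_bound_integrable])
    show "AE z in std_gauss. ((\<lambda>x. (z - shrinkage (x + z))\<^sup>2) \<longlongrightarrow> z\<^sup>2) at_top"
    proof (rule AE_I2)
      fix z
      have "((\<lambda>x. shrinkage (z + x)) \<longlongrightarrow> 0) at_top"
        by (intro filterlim_compose[OF shrinkage_at_top[OF assms]]
            filterlim_tendsto_add_at_top[OF tendsto_const] filterlim_ident)
      then have "((\<lambda>x. (z - shrinkage (z + x))\<^sup>2) \<longlongrightarrow> (z - 0)\<^sup>2) at_top"
        by (intro tendsto_intros)
      then show "((\<lambda>x. (z - shrinkage (x + z))\<^sup>2) \<longlongrightarrow> z\<^sup>2) at_top" by (simp add: add.commute)
    qed
    show "\<forall>\<^sub>F x in at_top. AE z in std_gauss.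
        norm ((z - shrinkage (x + z))\<^sup>2) \<le> 2 * z\<^sup>2 + 2 * (max 1 (2 * l))\<^sup>2"
      using shrinkage_risk_bound by (intro always_eventually allI AE_I2)
  qed measurable
  then show ?thesis by (simp add: risk_eq_shrinkage[abs_def] std_gauss_square)
qed

text \<open>A monotone function has countably many discontinuities, so almost every
  \<open>x + z\<close> is a continuity point of \<open>eta\<close>.\<close>

lemma risk_tendsto:
  assumes "X \<longlonglongrightarrow> x"
  shows "(\<lambda>n. risk p l 1 (X n)) \<longlonglongrightarrow> risk p l 1 x"
  unfolding risk_eq_shrinkage
proof (rule integral_dominated_convergence[OF _ _ shrinkage_risk_bound_integrable])
  have "countable ((\<lambda>y. y - x) ` {y. \<not> isCont (\<lambda>u. eta p u l) y})"
    by (intro countable_image mono_ctble_discont eta_mono)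
  then have "AE z in lborel. z \<notin> (\<lambda>y. y - x) ` {y. \<not> isCont (\<lambda>u. eta p u l) y}"
    by (intro AE_not_in countable_imp_null_set_lborel)
  then have "AE z in lborel. isCont (\<lambda>u. eta p u l) (x + z)"
    by eventually_elim (force simp: image_iff)
  then have "AE z in lborel. (\<lambda>n. (z - shrinkage (X n + z))\<^sup>2) \<longlonglongrightarrow> (z - shrinkage (x + z))\<^sup>2"
  proof eventually_elim
    case (elim z)
    have X: "(\<lambda>n. X n + z) \<longlonglongrightarrow> x + z" using assms by (intro tendsto_intros)
    show ?case
      unfolding shrinkage_def
      by (intro tendsto_power tendsto_diff tendsto_const X isCont_tendsto_compose[OF elim X])
  qed
  then show "AE z in std_gauss. (\<lambda>n. (z - shrinkage (X n + z))\<^sup>2) \<longlonglongrightarrow> (z - shrinkage (x + z))\<^sup>2"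
    unfolding std_gauss_def by (subst AE_density) auto
  show "AE z in std_gauss. norm ((z - shrinkage (X n + z))\<^sup>2) \<le> 2 * z\<^sup>2 + 2 * (max 1 (2 * l))\<^sup>2" for n
    using shrinkage_risk_bound by (intro AE_I2)
qed measurable

end

text \<open>The point mass at 0 has second moment 0, so this is an instance of
  \<open>amp_risk_at_top\<close>.\<close>

lemma risk_0_at_top:
  assumes "0 \<le> p" "p \<le> 1"
  shows "((\<lambda>l. risk p l 1 0) \<longlongrightarrow> 0) at_top"
proof -
  interpret sparse_law "two_point_law 0 0"
    using sparse_distsD(1)[OF two_point_law_sparse[of 0 0]] by simp
  have "((\<lambda>l. amp_risk p (two_point_law 0 0) 1 l) \<longlongrightarrow> 0) at_top"
    using amp_risk_at_top[OF assms, of 1] by (simp add: two_point_law_integral)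
  moreover have "\<forall>\<^sub>F l in at_top. amp_risk p (two_point_law 0 0) 1 l = risk p l 1 0"
    using eventually_ge_at_top[of 0]
  proof eventually_elim
    case (elim l)
    then have thr: "thresholding p l" using assms by unfold_locales
    show ?case
      unfolding amp_risk_eq[OF thr] by (simp add: two_point_law_integral risk_measurable[OF thr])
  qed
  ultimately show ?thesis by (rule Lim_transform_eventually)
qed

text \<open>First fix a penalty that makes the risk at 0 small, then let the mean grow; at that
  fixed penalty its risk tends to 1.\<close>

lemma best_two_point_risk_eventually_less:
  assumes "0 \<le> p" "p < 1" "0 \<le> \<epsilon>" "\<epsilon> \<le> 1" "\<epsilon> < c"
  shows "\<forall>\<^sub>F \<mu> in at_top. best_two_point_risk p \<epsilon> \<mu> < c"
proof -
  have "\<forall>\<^sub>F l in at_top. risk p l 1 0 < c - \<epsilon>"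
    using risk_0_at_top[of p] assms by (auto intro: order_tendstoD)
  then obtain l where lam: "0 \<le> l" "risk p l 1 0 < c - \<epsilon>"
    using eventually_happens[OF eventually_conj[OF eventually_ge_at_top[of 0]]] by force
  then interpret thresholding p l using assms by unfold_locales auto
  have "((\<lambda>\<mu>. (1 - \<epsilon>) * risk p l 1 0 + \<epsilon> * risk p l 1 \<mu>)
      \<longlongrightarrow> (1 - \<epsilon>) * risk p l 1 0 + \<epsilon> * 1) at_top"
    using risk_at_top assms by (intro tendsto_intros)
  moreover have "(1 - \<epsilon>) * risk p l 1 0 + \<epsilon> * 1 < c"
    using mult_right_mono[of "1 - \<epsilon>" 1 "risk p l 1 0"] risk_nonneg[of p l 1 0] lam assms by simp
  ultimately have "\<forall>\<^sub>F \<mu> in at_top. two_point_risk p \<epsilon> \<mu> l < c"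
    unfolding two_point_risk_eq by (rule order_tendstoD)
  then show ?thesis
    by eventually_elim (rule order_le_less_trans[OF best_two_point_risk_le[OF assms(3,4) lam(1)]])
qed

lemma M_lower_attained:
  assumes "0 \<le> p" "p < 1" "0 \<le> \<epsilon>" "\<epsilon> \<le> 1"
  shows "\<exists>\<mu>\<ge>0. M_lower p \<epsilon> \<le> best_two_point_risk p \<epsilon> \<mu>"
proof (cases "M_lower p \<epsilon> \<le> \<epsilon>")
  case True
  obtain m where m: "0 \<le> m" "\<And>l. 0 \<le> l \<Longrightarrow> 1 \<le> risk p l 1 m"
    using eventually_happens[OF eventually_conj[OF eventually_ge_at_top[of 0] eventually_risk_ge_1[of p]]]
      assms by auto
  have "\<epsilon> \<le> best_two_point_risk p \<epsilon> m"
    unfolding best_two_point_risk_def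
  proof (rule cINF_greatest)
    fix \<tau> :: real assume "\<tau> \<in> {0..}"
    then have "\<epsilon> * 1 \<le> \<epsilon> * risk p \<tau> 1 m" using m assms by (intro mult_left_mono) auto
    moreover have "0 \<le> (1 - \<epsilon>) * risk p \<tau> 1 0" using assms risk_nonneg by simp
    ultimately show "\<epsilon> \<le> two_point_risk p \<epsilon> m \<tau>" by (simp add: two_point_risk_eq)
  qed simp
  then show ?thesis using True m by force
next
  case False
  define S where "S = M_lower p \<epsilon>"
  \<comment> \<open>A level strictly between \<open>\<epsilon>\<close> and the supremum: forcing the
    maximizing sequence above \<open>c\<close> confines it to \<open>[0, N]\<close>.\<close>
  define c where "c = (S + \<epsilon>) / 2"
  have c: "\<epsilon> < c" "c < S" using False by (auto simp: S_def c_def)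
  obtain N where N: "\<And>\<mu>. N \<le> \<mu> \<Longrightarrow> best_two_point_risk p \<epsilon> \<mu> < c"
    using best_two_point_risk_eventually_less[OF assms c(1)] by (auto simp: eventually_at_top_linorder)
  have bdd: "bdd_above (best_two_point_risk p \<epsilon> ` {0..})"
    using assms by (intro best_two_point_risk_bdd_above) auto
  have "\<exists>\<mu>\<ge>0. max c (S - inverse (real (Suc n))) < best_two_point_risk p \<epsilon> \<mu>" for n
  proof -
    have "max c (S - inverse (real (Suc n))) < S" using c by simp
    then have "\<exists>\<mu>\<in>{0..}. max c (S - inverse (real (Suc n))) < best_two_point_risk p \<epsilon> \<mu>"
      by (subst less_cSUP_iff[OF _ bdd, symmetric]) (simp_all only: S_def M_lower_eq, simp)
    then show ?thesis by (simp only: Bex_def atLeast_iff)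
  qed
  then obtain X where X: "\<And>n. 0 \<le> X n" "\<And>n. max c (S - inverse (real (Suc n))) < best_two_point_risk p \<epsilon> (X n)"
    by metis
  have "X n \<in> {0..N}" for n
    using X[of n] N[of "X n"] by (cases "N \<le> X n") auto
  then obtain x r where x: "x \<in> {0..N}" "strict_mono r" "(X \<circ> r) \<longlonglongrightarrow> x"
    using compact_Icc[of 0 N] unfolding compact_def by metis
  \<comment> \<open>An infimum of continuous functions is upper semicontinuous: the limit is taken
    for each \<open>\<tau>\<close> separately.\<close>
  have "S \<le> best_two_point_risk p \<epsilon> x"
    unfolding best_two_point_risk_def
  proof (rule cINF_greatest)
    fix \<tau> :: real assume "\<tau> \<in> {0..}"
    then interpret thresholding p \<tau> using assms by unfold_locales auto
    show "S \<le> two_point_risk p \<epsilon> x \<tau>"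
    proof (rule LIMSEQ_le)
      show "(\<lambda>n. two_point_risk p \<epsilon> ((X \<circ> r) n) \<tau>) \<longlonglongrightarrow> two_point_risk p \<epsilon> x \<tau>"
        unfolding two_point_risk_eq by (intro tendsto_intros risk_tendsto x(3))
      have "(\<lambda>n. S - inverse (real (Suc n))) \<longlonglongrightarrow> S - 0"
        by (intro tendsto_intros LIMSEQ_inverse_real_of_nat)
      then have "((\<lambda>n. S - inverse (real (Suc n))) \<circ> r) \<longlonglongrightarrow> S - 0"
        using x(2) by (rule LIMSEQ_subseq_LIMSEQ)
      then show "(\<lambda>n. S - inverse (real (Suc (r n)))) \<longlonglongrightarrow> S" by (simp add: o_def)
      show "\<exists>N. \<forall>n\<ge>N. S - inverse (real (Suc (r n))) \<le> two_point_risk p \<epsilon> ((X \<circ> r) n) \<tau>"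
      proof (intro exI allI impI)
        fix n
        have "S - inverse (real (Suc (r n))) \<le> best_two_point_risk p \<epsilon> (X (r n))"
          using X(2)[of "r n"] by simp
        also have "\<dots> \<le> two_point_risk p \<epsilon> ((X \<circ> r) n) \<tau>"
          using best_two_point_risk_le[OF assms(3,4) l] by simp
        finally show "S - inverse (real (Suc (r n))) \<le> two_point_risk p \<epsilon> ((X \<circ> r) n) \<tau>" .
      qed
    qed
  qed simp
  then show ?thesis using x(1) by (auto simp: S_def)
qed

text \<open>Attainment rests on the decay of shrinkage for \<open>p < 1\<close>, or on independence
  of the mean for \<open>\<epsilon> = 0\<close>. The last conclusion needs only near-maximizers of
  the supremum and so includes \<open>p = 1\<close>.\<close>

theorem theorem10:
  fixes p \<delta> \<epsilon> :: real
  assumes "0 \<le> p" and "p \<le> 1"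
    and "0 < \<delta>" and "\<delta> < 1"
    and "0 \<le> \<epsilon>" and "\<epsilon> \<le> 1"
  shows "(M_upper p \<epsilon> < \<delta> \<longrightarrow>
            (\<forall>PX \<in> sparse_dists \<epsilon>. \<forall>sw > 0. \<exists>sh.
               highest_fixed_point p \<delta> sw PX sh \<and>
               sh\<^sup>2 / sw\<^sup>2 \<le> 1 / (1 - M_upper p \<epsilon> / \<delta>)))
       \<and> (p < 1 \<or> \<epsilon> = 0 \<longrightarrow>
            (\<exists>PX \<in> sparse_dists \<epsilon>. \<exists>sw > 0. \<exists>sh.
               highest_fixed_point p \<delta> sw PX sh \<and>
               sh\<^sup>2 / sw\<^sup>2 \<ge> 1 / (1 - M_lower p \<epsilon> / \<delta>)))
       \<and> (\<forall>c < 1 / (1 - M_lower p \<epsilon> / \<delta>).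
            \<exists>PX \<in> sparse_dists \<epsilon>. \<exists>sw > 0. \<exists>sh.
               highest_fixed_point p \<delta> sw PX sh \<and>
               sh\<^sup>2 / sw\<^sup>2 \<ge> c)"
proof -
  define M where "M = M_lower p \<epsilon>"
  define Q where "Q c \<longleftrightarrow> (\<exists>PX \<in> sparse_dists \<epsilon>. \<exists>sw > 0. \<exists>sh.
    highest_fixed_point p \<delta> sw PX sh \<and> sh\<^sup>2 / sw\<^sup>2 \<ge> c)" for c
  have Q1: "Q c" if "c \<le> 1" for c
    unfolding Q_def using assms that by (intro highest_fixed_point_ge_1)
  have Qh: "Q (1 / (1 - best_two_point_risk p \<epsilon> \<mu> / \<delta>))" if "best_two_point_risk p \<epsilon> \<mu> < \<delta>" for \<mu>
    unfolding Q_def using assms that by (intro highest_fixed_point_ge)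
  have bdd: "bdd_above (best_two_point_risk p \<epsilon> ` {0..})"
    using assms by (intro best_two_point_risk_bdd_above) auto
  have h_le: "best_two_point_risk p \<epsilon> \<mu> \<le> M" if "0 \<le> \<mu>" for \<mu>
    unfolding M_def M_lower_eq using that by (intro cSUP_upper[OF _ bdd]) simp
  \<comment> \<open>For \<open>\<delta> \<le> M\<close> the bound is nonpositive, equal to 0 when
    \<open>M = \<delta>\<close> since division by zero gives 0; targets up to 1 are already
    settled.\<close>
  have nonpos: "1 / (1 - M / \<delta>) \<le> 1" if "\<delta> \<le> M"
  proof -
    have "1 - M / \<delta> \<le> 0" using that assms by simp
    then have "1 / (1 - M / \<delta>) \<le> 0" by (intro divide_nonneg_nonpos) simp_all
    then show ?thesis by linarith
  qed
  have "\<exists>sh. highest_fixed_point p \<delta> sw PX sh \<and> sh\<^sup>2 / sw\<^sup>2 \<le> 1 / (1 - M_upper p \<epsilon> / \<delta>)"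
    if M: "M_upper p \<epsilon> < \<delta>" and PX: "PX \<in> sparse_dists \<epsilon>" and sw: "0 < sw" for PX sw
  proof -
    interpret sparse_law PX using sparse_distsD[OF PX] by simp
    obtain sh where sh: "highest_fixed_point p \<delta> sw PX sh" "sw \<le> sh"
      using highest_fixed_point_exists assms sw by metis
    then have "sh\<^sup>2 / sw\<^sup>2 \<le> 1 / (1 - M_upper p \<epsilon> / \<delta>)"
      using assms M PX sw by (intro fixed_point_le) (auto simp: highest_fixed_point_def)
    then show ?thesis using sh by blast
  qed
  moreover have "Q (1 / (1 - M / \<delta>))" if "p < 1 \<or> \<epsilon> = 0"
  proof (cases "\<delta> \<le> M")
    case True
    then show ?thesis using Q1 nonpos by blast
  next
    case False
    have "\<exists>\<mu>\<ge>0. M \<le> best_two_point_risk p \<epsilon> \<mu>"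
    proof (cases "\<epsilon> = 0")
      case True
      then have "best_two_point_risk p \<epsilon> \<mu> = best_two_point_risk p \<epsilon> 0" for \<mu>
        by (simp add: best_two_point_risk_def two_point_risk_eq)
      then have "M \<le> best_two_point_risk p \<epsilon> 0"
        unfolding M_def M_lower_eq by (intro cSUP_least eq_refl) (auto simp only: atLeast_iff)
      then show ?thesis by blast
    qed (use M_lower_attained that assms in \<open>simp add: M_def\<close>)
    then obtain \<mu> where "best_two_point_risk p \<epsilon> \<mu> = M" using h_le by force
    then show ?thesis using Qh[of \<mu>] False by simp
  qed
  moreover have "Q c" if c: "c < 1 / (1 - M / \<delta>)" for c
  proof (cases "c \<le> 1")
    case False
    then have "M < \<delta>" using nonpos c by force
    \<comment> \<open>Solving \<open>c < 1 / (1 - M / \<delta>)\<close> for \<open>M\<close> gives a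
      level below the supremum, which some mean exceeds.\<close>
    then have "\<delta> * (1 - 1 / c) < M" using c False assms by (simp add: field_simps)
    then have "\<exists>\<mu>\<in>{0..}. \<delta> * (1 - 1 / c) < best_two_point_risk p \<epsilon> \<mu>"
      by (subst less_cSUP_iff[OF _ bdd, symmetric]) (simp_all only: M_def M_lower_eq, simp)
    then obtain \<mu> where \<mu>: "0 \<le> \<mu>" "\<delta> * (1 - 1 / c) < best_two_point_risk p \<epsilon> \<mu>"
      by (auto simp only: Bex_def atLeast_iff)
    then have less: "best_two_point_risk p \<epsilon> \<mu> < \<delta>" using h_le[of \<mu>] \<open>M < \<delta>\<close> by simp
    then have "c \<le> 1 / (1 - best_two_point_risk p \<epsilon> \<mu> / \<delta>)"
      using \<mu> False assms by (simp add: field_simps)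
    then show ?thesis using Qh[OF less] unfolding Q_def by (meson order_trans)
  qed (rule Q1)
  ultimately show ?thesis unfolding Q_def M_def by blast
qed

end
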